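(* For all constants $C_{\mathsf{var}},C_{\mathsf{int}}>0$ there exist constants $C_1,C_2>0$, depending only on $C_{\mathsf{var}}$ and $C_{\mathsf{int}}$, such that the following holds. Let $n\ge2$, let $\{P_\theta\}_{\theta\in\Theta}$ be a regular one-parameter exponential family with log-partition function $b$, let $V_{\min}<V_{\max}$ lie in the image of $b'$, put $\theta_{\min}=(b')^{-1}(V_{\min})$, $\theta_{\max}=(b')^{-1}(V_{\max})$ and $$\sigma^2=\max_{\theta_{\min}\le\theta\le\theta_{\max}}b''(\theta),$$ and assume $V_{\max}-V_{\min}\ge\sigma/\sqrt n$. Assume moreover that there is an interval $[\widetilde V_{\min},\widetilde V_{\max}]\subseteq[V_{\min},V_{\max}]$ with $\widetilde V_{\max}-\widetilde V_{\min}\ge C_{\mathsf{int}}(V_{\max}-V_{\min})$ such that $b''(\theta)\ge C_{\mathsf{var}}\sigma^2$ for $\theta=(b')^{-1}(\mu)$ and every $\mu\in[\widetilde V_{\min},\widetilde V_{\max}]$. For $\boldsymbol\mu^\star\in\mathbb{R}^n$ with $V_{\min}\le\mu_i^\star\le V_{\max}$ for all $i$ (written $V_{\min}\le\boldsymbol\mu^\star\le V_{\max}$), let $X_1,\dots,X_n$ be independent with $X_i\sim P_{\theta_i^\star}$, $\theta_i^\star=(b')^{-1}(\mu_i^\star)$. Then $$\sup_{V_{\min}\le\boldsymbol\mu^\star\le V_{\max}}\mathbb{E}\|\widehat{\boldsymbol\mu}-\boldsymbol\mu^\star\|^2\le C_1n\sigma^2\min\Big\{1,\Big(\frac{V_{\max}-V_{\min}}{n\sigma}\Big)^{2/3}+\frac{\log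 n}{n}\Big\},$$ where $\widehat{\boldsymbol\mu}$ is the minimizer of $\sum_{i=1}^n(X_i-\mu_i)^2$ subject to $\mu_{\pi^\star(1)}\ge\cdots\ge\mu_{\pi^\star(n)}$, with $\pi^\star$ a permutation satisfying $\mu^\star_{\pi^\star(1)}\ge\cdots\ge\mu^\star_{\pi^\star(n)}$; and $$\inf_{\widetilde{\boldsymbol\mu}}\ \sup_{V_{\min}\le\boldsymbol\mu^\star\le V_{\max}}\mathbb{E}\|\widetilde{\boldsymbol\mu}-\boldsymbol\mu^\star\|^2\ge C_2n\sigma^2\min\Big\{1,\Big(\frac{V_{\max}-V_{\min}}{n\sigma}\Big)^{2/3}+\frac1n\Big\},$$ where the infimum is over all estimators $\widetilde{\boldsymbol\mu}$ of $\boldsymbol\mu^\star$, i.e. measurable functions of the data $X_1,\dots,X_n$ with values in $\mathbb{R}^n$.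
   Context: Regular one-parameter exponential family: there are a base measure $\rho$ on $\mathbb{R}$, a carrier function $c\ge 0$, an open interval $\Theta\subseteq\mathbb{R}$, and a log-partition function $b:\Theta\to\mathbb{R}$ such that for each $\theta\in\Theta$, $P_\theta$ has density $p_\theta(x)=e^{\theta x-b(\theta)}c(x)$ with respect to $\rho$; $b$ is twice differentiable with $b''(\theta)>0$ on $\Theta$. One has $\mathbb{E}_\theta[X]=b'(\theta)$ and $\mathrm{Var}_\theta(X)=b''(\theta)\in(0,\infty)$, and $b'$ is strictly increasing. $\|\cdot\|$ denotes the Euclidean norm. *)

theory Defs
  imports "HOL-Probability.Probability" "HOL-Combinatorics.Permutations"
begin

definition exp_family_measure ::
  "real measure \<Rightarrow> (real \<Rightarrow> real) \<Rightarrow> (real \<Rightarrow> real) \<Rightarrow> real \<Rightarrow> real measure" where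
  "exp_family_measure \<rho> c b \<theta> = density \<rho> (\<lambda>x. ennreal (exp (\<theta> * x - b \<theta>) * c x))"

text \<open>
  Since \<open>\<Theta>\<close> is open, \<^term>\<open>deriv b\<close> and \<^term>\<open>deriv (deriv b)\<close> on \<open>\<Theta>\<close>
  depend only on the values of \<open>b\<close> on \<open>\<Theta>\<close>.  The base measure is not required to be
  \<open>\<sigma>\<close>-finite.  The identities for the mean and the variance and the strict monotonicity of
  \<open>b'\<close> are consequences of these axioms and hence are not among them.
\<close>

locale regular_exp_family =
  fixes \<rho> :: "real measure" and c :: "real \<Rightarrow> real" and \<Theta> :: "real set" and b :: "real \<Rightarrow> real"
  assumes sets_base: "sets \<rho> = sets borel"
    and carrier_measurable: "c \<in> borel_measurable borel"
    and carrier_nonneg: "\<And>x. c x \<ge> 0"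
    and open_params: "open \<Theta>"
    and interval_params: "is_interval \<Theta>"
    and prob_space_family: "\<And>\<theta>. \<theta> \<in> \<Theta> \<Longrightarrow> prob_space (exp_family_measure \<rho> c b \<theta>)"
    and differentiable: "\<And>\<theta>. \<theta> \<in> \<Theta> \<Longrightarrow> b field_differentiable at \<theta>"
    and differentiable_twice: "\<And>\<theta>. \<theta> \<in> \<Theta> \<Longrightarrow> deriv b field_differentiable at \<theta>"
    and deriv2_pos: "\<And>\<theta>. \<theta> \<in> \<Theta> \<Longrightarrow> deriv (deriv b) \<theta> > 0"

definition natural_param :: "real set \<Rightarrow> (real \<Rightarrow> real) \<Rightarrow> real \<Rightarrow> real" where
  "natural_param \<Theta> b = inv_into \<Theta> (deriv b)"

text \<open>\<open>GREATEST\<close> is the maximum of the set; it is attained because \<open>b''\<close> is continuous.\<close>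

definition max_variance :: "real set \<Rightarrow> (real \<Rightarrow> real) \<Rightarrow> real \<Rightarrow> real \<Rightarrow> real" where
  "max_variance \<Theta> b Vmin Vmax =
     (GREATEST v. v \<in> deriv (deriv b) ` {natural_param \<Theta> b Vmin .. natural_param \<Theta> b Vmax})"

text \<open>
  As the dimension \<open>n\<close> is quantified after the constants, vectors in \<open>\<real>\<^sup>n\<close> are functions
  on \<open>{..<n}\<close>, extended by \<^const>\<open>undefined\<close> so that equality is equality of vectors.
\<close>

definition mean_box :: "nat \<Rightarrow> real \<Rightarrow> real \<Rightarrow> (nat \<Rightarrow> real) set" where
  "mean_box n Vmin Vmax = (\<Pi>\<^sub>E i\<in>{..<n}. {Vmin..Vmax})"

text \<open>Joint law of independent \<open>X\<^sub>i\<close> whose distributions have means \<open>\<mu>\<^sub>i\<close>.\<close>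

definition data_law ::
  "real measure \<Rightarrow> (real \<Rightarrow> real) \<Rightarrow> real set \<Rightarrow> (real \<Rightarrow> real) \<Rightarrow> nat \<Rightarrow> (nat \<Rightarrow> real)
     \<Rightarrow> (nat \<Rightarrow> real) measure" where
  "data_law \<rho> c \<Theta> b n \<mu> =
     (\<Pi>\<^sub>M i\<in>{..<n}. exp_family_measure \<rho> c b (natural_param \<Theta> b (\<mu> i)))"

definition estimators :: "nat \<Rightarrow> ((nat \<Rightarrow> real) \<Rightarrow> (nat \<Rightarrow> real)) set" where
  "estimators n = measurable (\<Pi>\<^sub>M i\<in>{..<n}. (borel :: real measure)) (\<Pi>\<^sub>M i\<in>{..<n}. borel)"

text \<open>The risk takes values in \<open>[0, \<infinity>]\<close>, so no integrability condition is needed.\<close>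

definition risk ::
  "real measure \<Rightarrow> (real \<Rightarrow> real) \<Rightarrow> real set \<Rightarrow> (real \<Rightarrow> real) \<Rightarrow> nat
     \<Rightarrow> ((nat \<Rightarrow> real) \<Rightarrow> (nat \<Rightarrow> real)) \<Rightarrow> (nat \<Rightarrow> real) \<Rightarrow> ennreal" where
  "risk \<rho> c \<Theta> b n est \<mu> =
     (\<integral>\<^sup>+ x. ennreal ((L2_set (\<lambda>i. est x i - \<mu> i) {..<n})\<^sup>2) \<partial>data_law \<rho> c \<Theta> b n \<mu>)"

definition sorting_perm :: "nat \<Rightarrow> (nat \<Rightarrow> real) \<Rightarrow> (nat \<Rightarrow> nat) \<Rightarrow> bool" where
  "sorting_perm n \<mu> \<pi> \<longleftrightarrow> \<pi> permutes {..<n} \<and> antimono_on {..<n} (\<lambda>i. \<mu> (\<pi> i))"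

text \<open>The minimizer exists and is unique: it is the projection of the data onto a closed convex cone.\<close>

definition isotonic_lse :: "nat \<Rightarrow> (nat \<Rightarrow> nat) \<Rightarrow> (nat \<Rightarrow> real) \<Rightarrow> (nat \<Rightarrow> real)" where
  "isotonic_lse n \<pi> x =
     arg_min_on (\<lambda>m. \<Sum>i<n. (x i - m i)\<^sup>2)
       {m \<in> extensional {..<n}. antimono_on {..<n} (\<lambda>i. m (\<pi> i))}"

end

(*
  Lower bound.  The estimator does not know the order of the means, so it suffices to let every
  mean range over the same two points m0 < m1 in the interval of large variance, independently of
  the others.  The two laws of a single coordinate have Hellinger affinity
  exp (b ((r + s) / 2) - (b r + b s) / 2), which is at least exp (- (s - r) (m1 - m0) / 4) by
  convexity of b, so each coordinate costs a constant multiple of (m1 - m0)^2.  Since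
  Vmax - Vmin >= \<sigma> / sqrt n, the resulting bound n min (\<sigma>^2, (Vmax - Vmin)^2)
  dominates the stated rate.

  Upper bound.  By the min-max characterisation, the isotonic fit at i exceeds the truth f i by at
  most the bias f v - f i plus the largest average of the noise over blocks that start at v and
  reach at least i.  A maximal inequality makes the second moment of the latter O(\<sigma>^2 / m)
  with m = i - v + 1.  Balancing the two terms for each i separately, with a window length m i
  that depends on f, gives the risk O(\<sigma>^2 (sum of 1 / m i)), and the total drop of f bounds
  this sum without a logarithmic factor in the main term.
*)

theory Submission
  imports Defs
begin

section \<open>A maximal inequality for averages\<close>

text \<open>The block over which the fit averages ends at a data-dependent position, so the noise
  has to be controlled for all block lengths k >= m at once, from two moments. Doob's inequality for
  the plain partial sums would pay for the variance of the longest block. The increments are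
  therefore damped by \<open>max (j + 1) m\<close>: the damped sum has variance at most 2 / m times
  that of one observation, and summation by parts recovers the averages from its oscillation. The
  main term has no logarithm because the cost 1 / m i of a short window is charged to drops of f
  weighted by 1 / sqrt (lag). These weights do not depend on i, so summing over i first telescopes
  to at most V at each lag, and the sum of 1 / sqrt k up to 1 / q is of order 1 / sqrt q. With w = V
  / (n s), the balance w / sqrt q = q gives q = w^(2/3). The term log n / n is the price of windows
  cut off by the boundary, where m i = i + 1. All pathwise inequalities end in integrable majorants
  Z, and only these are integrated.\<close>

fun running_max :: "(nat \<Rightarrow> real) \<Rightarrow> nat \<Rightarrow> real" where
  "running_max U 0 = 0"
| "running_max U (Suc k) = max (running_max U k) (U (Suc k))"

lemma running_max_nonneg: "running_max U k \<ge> 0"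
  by (induction k) auto

lemma running_max_ge:
  assumes "U 0 = 0" "j \<le> k"
  shows "U j \<le> running_max U k"
  using assms(2) by (induction k) (auto simp: assms(1) le_Suc_eq)

lemma running_max_cong:
  assumes "\<And>j. j \<le> k \<Longrightarrow> U j = W j"
  shows "running_max U k = running_max W k"
  using assms by (induction k) auto

text \<open>A crude bound that serves integrability: the running maximum of integrable variables is
  integrable.\<close>

lemma running_max_le_sum: "running_max U k \<le> (\<Sum>j\<le>k. \<bar>U j\<bar>)"
proof (induction k)
  case (Suc k)
  have "0 \<le> (\<Sum>j\<le>k. \<bar>U j\<bar>)" by (intro sum_nonneg) auto
  moreover have "U (Suc k) \<le> \<bar>U (Suc k)\<bar>" by simp
  ultimately show ?case
    using Suc unfolding running_max.simps sum.atMost_Suc by (intro max.boundedI) linarith+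
qed auto

text \<open>The pathwise form of Doob's \<open>L\<^sup>2\<close> inequality: summation by parts of \<open>\<Sum> d(R\<^sup>2)\<close>, using
  that the running maximum \<open>R\<close> only increases at times when \<open>R = U\<close>.\<close>

lemma running_max_doob:
  assumes "U 0 = 0"
  shows "(running_max U k)\<^sup>2 \<le> 4 * (U k)\<^sup>2 - 4 * (\<Sum>j<k. running_max U j * (U (Suc j) - U j))"
proof -
  have "(running_max U k)\<^sup>2 - 2 * running_max U k * U k
          + 2 * (\<Sum>j<k. running_max U j * (U (Suc j) - U j)) \<le> 0"
  proof (induction k)
    case (Suc k)
    define R where "R = running_max U k"
    \<comment> \<open>This is the increment of the left side of the claim, with \<open>R'\<close>
      and \<open>u'\<close> the values at \<open>Suc k\<close>: zero if the maximum stays, minus the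
      squared jump if it moves.\<close>
    have *: "R' \<^sup>2 - 2 * R' * u' + 2 * R * u' - R\<^sup>2 \<le> 0" if "R' = max R u'" for R' u' :: real
    proof (cases "u' \<le> R")
      case False
      then have "R' = u'" using that by auto
      then have "R' \<^sup>2 - 2 * R' * u' + 2 * R * u' - R\<^sup>2 = - (R - u')\<^sup>2"
        by (simp add: power2_eq_square algebra_simps)
      then show ?thesis by simp
    qed (use that in auto)
    from *[of "running_max U (Suc k)" "U (Suc k)"] Suc show ?case
      by (simp add: R_def algebra_simps)
  qed (use assms in auto)
  \<comment> \<open>Half of the squared maximum is absorbed on the left, which produces the factors
    4.\<close>
  moreover have "2 * running_max U k * U k \<le> (running_max U k)\<^sup>2 / 2 + 2 * (U k)\<^sup>2"
    using sum_squares_bound[of "running_max U k" "2 * U k"]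
    by (simp add: power2_eq_square algebra_simps)
  ultimately show ?thesis by linarith
qed

text \<open>The increments of \<open>U\<close> carry the weights \<open>1 / max (j + 1) m\<close>, so that a bound on the
  oscillation of \<open>U\<close> bounds the averages of length at least \<open>m\<close> (as in Kronecker's lemma).\<close>

definition weighted_sum :: "nat \<Rightarrow> (nat \<Rightarrow> real) \<Rightarrow> nat \<Rightarrow> real" where
  "weighted_sum m x k = (\<Sum>j<k. x j / real (max (Suc j) m))"

lemma weighted_sum_0 [simp]: "weighted_sum m x 0 = 0"
  by (simp add: weighted_sum_def)

lemma weighted_sum_Suc:
  "weighted_sum m x (Suc k) = weighted_sum m x k + x k / real (max (Suc k) m)"
  by (simp add: weighted_sum_def)

lemma weighted_sum_cong:
  "(\<And>j. j < k \<Longrightarrow> x j = y j) \<Longrightarrow> weighted_sum m x k = weighted_sum m y k"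
  by (auto simp: weighted_sum_def intro: sum.cong)

lemma weighted_sum_uminus: "weighted_sum m (\<lambda>j. - x j) k = - weighted_sum m x k"
  by (simp add: weighted_sum_def sum_negf)

text \<open>Abel summation: \<open>x j\<close> is \<open>max (Suc j) m\<close> times an increment of
  the weighted sum. These factors do not decrease and the weighted sum stays above
  \<open>lo\<close>, so enlarging the factor at each step keeps the inequality.\<close>

lemma sum_le_weighted_sum:
  assumes "\<And>j. j \<le> k \<Longrightarrow> lo \<le> weighted_sum m x j"
  shows "(\<Sum>j<k. x j) \<le> real (max k m) * (weighted_sum m x k - lo)"
  using assms
proof (induction k)
  case 0
  then show ?case by (auto intro: mult_nonneg_nonpos)
next
  case (Suc k)
  let ?U = "weighted_sum m x" and ?c = "real (max (Suc k) m)"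
  have "(\<Sum>j<k. x j) \<le> real (max k m) * (?U k - lo)" using Suc by auto
  also have "\<dots> \<le> ?c * (?U k - lo)" using Suc.prems[of k] by (intro mult_right_mono) auto
  finally have "(\<Sum>j<Suc k. x j) \<le> ?c * (?U k - lo) + x k" by simp
  also have "?c * (?U k - lo) + x k = ?c * (?U (Suc k) - lo)"
    by (simp add: weighted_sum_Suc field_simps max_def)
  finally show ?case .
qed

text \<open>For \<open>k \<ge> m\<close> the factor \<open>max k m\<close> is \<open>k\<close>
  itself and cancels against the length of the block. The lower bound \<open>lo\<close> is minus the
  running maximum of the negated sums.\<close>

lemma average_le_running_max:
  assumes "0 < m" "m \<le> k" "k \<le> N"
  shows "(\<Sum>j<k. x j) / real k \<le> running_max (weighted_sum m x) N
           + running_max (weighted_sum m (\<lambda>j. - x j)) N"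
proof -
  let ?U = "weighted_sum m x" and ?W = "weighted_sum m (\<lambda>j. - x j)"
  have "- running_max ?W N \<le> ?U j" if "j \<le> k" for j
    using running_max_ge[of ?W j N] that assms by (simp add: weighted_sum_uminus)
  from sum_le_weighted_sum[of k, OF this]
  have "(\<Sum>j<k. x j) \<le> real k * (?U k + running_max ?W N)"
    using assms by (simp add: max_def)
  also have "\<dots> \<le> real k * (running_max ?U N + running_max ?W N)"
    using running_max_ge[of ?U k N] assms by (intro mult_left_mono) auto
  finally show ?thesis using assms by (simp add: field_simps)
qed

text \<open>The first \<open>m\<close> terms add up to \<open>1 / m\<close>; beyond them
  \<open>1 / (j + 1)^2 \<le> 1 / j - 1 / (j + 1)\<close> telescopes to at most another
  \<open>1 / m\<close>. The induction carries the remainder \<open>- 1 / N\<close>.\<close>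

lemma sum_inverse_squares_max:
  assumes "0 < m"
  shows "(\<Sum>j<N. 1 / (real (max (Suc j) m))\<^sup>2) \<le> 2 / real m"
proof -
  have "(\<Sum>j<N. 1 / (real (max (Suc j) m))\<^sup>2)
          \<le> (if N \<le> m then real N / (real m)\<^sup>2 else 2 / real m - 1 / real N)"
  proof (induction N)
    case (Suc N)
    consider "Suc N \<le> m" | "N = m" | "N > m" by linarith
    then show ?case
    proof cases
      case 1
      then show ?thesis using Suc by (auto simp: max_def add_divide_distrib)
    next
      case 2
      have "1 / real m + 1 / (1 + real m)\<^sup>2 \<le> 2 / real m - 1 / (1 + real m)"
        using assms by (simp add: divide_simps power2_eq_square) (auto simp: algebra_simps)
      moreover have "real m / (real m)\<^sup>2 = 1 / real m"
        by (simp add: power2_eq_square)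
      ultimately show ?thesis using Suc 2 by (auto simp: max_def)
    next
      case 3
      have "1 / (1 + real N)\<^sup>2 \<le> 1 / real N - 1 / (1 + real N)"
        using 3 by (simp add: divide_simps power2_eq_square)
      then show ?thesis using Suc 3 by (auto simp: max_def)
    qed
  qed auto
  also have "\<dots> \<le> 2 / real m"
    using assms by (auto simp: divide_simps power2_eq_square)
  finally show ?thesis .
qed

lemma measurable_weighted_sum:
  assumes "k \<le> N"
  shows "(\<lambda>x. weighted_sum m x k) \<in> borel_measurable (PiM {..<N} (\<lambda>_. borel))"
  unfolding weighted_sum_def using assms
  by (intro borel_measurable_sum borel_measurable_divide measurable_component_singleton) auto

lemma measurable_running_max_weighted_sum:
  assumes "k \<le> N"
  shows "(\<lambda>x. running_max (weighted_sum m x) k) \<in> borel_measurable (PiM {..<N} (\<lambda>_. borel))"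
  using assms
proof (induction k)
  case (Suc k)
  then show ?case
    using measurable_weighted_sum[of "Suc k" N m] by auto
qed auto

section \<open>Second moments of the running maximum for independent noise\<close>

context prob_space
begin

text \<open>Plays the part of the martingale difference property. Sequences are functions on all of
  \<open>nat\<close>, so \<open>cong\<close> is what says that \<open>g\<close> looks only at
  coordinates below \<open>k\<close>; then \<open>g\<close> of the past is independent of the
  centred \<open>\<xi> k\<close>.\<close>

lemma indep_vars_prefix_orthogonal:
  fixes \<xi> :: "nat \<Rightarrow> 'a \<Rightarrow> real"
  assumes ind: "indep_vars (\<lambda>_. borel) \<xi> {..<N}" and k: "k < N"
    and g: "g \<in> borel_measurable (PiM {..<k} (\<lambda>_. borel))"
    and cong: "\<And>x. g (restrict x {..<k}) = g x"
    and int: "integrable M (\<lambda>\<omega>. g (\<lambda>j. \<xi> j \<omega>))" "integrable M (\<xi> k)"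
    and mean: "expectation (\<xi> k) = 0"
  shows "integrable M (\<lambda>\<omega>. g (\<lambda>j. \<xi> j \<omega>) * \<xi> k \<omega>)"
    and "expectation (\<lambda>\<omega>. g (\<lambda>j. \<xi> j \<omega>) * \<xi> k \<omega>) = 0"
proof -
  have "indep_var (PiM {..<k} (\<lambda>_. borel)) (\<lambda>\<omega>. restrict (\<lambda>i. \<xi> i \<omega>) {..<k})
                  (PiM {k} (\<lambda>_. borel)) (\<lambda>\<omega>. restrict (\<lambda>i. \<xi> i \<omega>) {k})"
    using k by (intro indep_var_restrict[OF ind]) auto
  from indep_var_compose[OF this g, of "\<lambda>x. x k" borel]
  have "indep_var borel (g \<circ> (\<lambda>\<omega>. restrict (\<lambda>i. \<xi> i \<omega>) {..<k}))
                  borel ((\<lambda>x. x k) \<circ> (\<lambda>\<omega>. restrict (\<lambda>i. \<xi> i \<omega>) {k}))"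
    by auto
  then have "indep_var borel (\<lambda>\<omega>. g (\<lambda>j. \<xi> j \<omega>)) borel (\<xi> k)"
    by (simp add: o_def cong)
  from indep_var_integrable[OF this int] indep_var_lebesgue_integral[OF this int] mean
  show "integrable M (\<lambda>\<omega>. g (\<lambda>j. \<xi> j \<omega>) * \<xi> k \<omega>)"
    and "expectation (\<lambda>\<omega>. g (\<lambda>j. \<xi> j \<omega>) * \<xi> k \<omega>) = 0" by auto
qed

context
  fixes \<xi> :: "nat \<Rightarrow> 'a \<Rightarrow> real" and N :: nat and s :: real
  assumes ind: "indep_vars (\<lambda>_. borel) \<xi> {..<N}"
    and sq: "\<And>j. j < N \<Longrightarrow> integrable M (\<lambda>\<omega>. (\<xi> j \<omega>)\<^sup>2)"
    and mean: "\<And>j. j < N \<Longrightarrow> expectation (\<xi> j) = 0"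
    and var: "\<And>j. j < N \<Longrightarrow> expectation (\<lambda>\<omega>. (\<xi> j \<omega>)\<^sup>2) \<le> s"
begin

lemma indep_seq_measurable: "j < N \<Longrightarrow> \<xi> j \<in> borel_measurable M"
  using ind by (auto simp: indep_vars_def)

lemma indep_seq_integrable: "j < N \<Longrightarrow> integrable M (\<xi> j)"
  by (rule square_integrable_imp_integrable[OF indep_seq_measurable sq]) auto

lemma integrable_weighted_sum:
  "k \<le> N \<Longrightarrow> integrable M (\<lambda>\<omega>. weighted_sum m (\<lambda>j. \<xi> j \<omega>) k)"
  unfolding weighted_sum_def by (intro Bochner_Integration.integrable_sum integrable_divide indep_seq_integrable) auto

lemma weighted_sum_random_variable:
  "k \<le> N \<Longrightarrow> (\<lambda>\<omega>. weighted_sum m (\<lambda>j. \<xi> j \<omega>) k) \<in> borel_measurable M"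
  using integrable_weighted_sum by blast

lemma running_max_random_variable:
  "k \<le> N \<Longrightarrow> (\<lambda>\<omega>. running_max (weighted_sum m (\<lambda>j. \<xi> j \<omega>)) k) \<in> borel_measurable M"
  by (induction k) (auto intro!: borel_measurable_max weighted_sum_random_variable)

lemma integrable_running_max:
  assumes "k \<le> N"
  shows "integrable M (\<lambda>\<omega>. running_max (weighted_sum m (\<lambda>j. \<xi> j \<omega>)) k)"
proof (rule Bochner_Integration.integrable_bound)
  show "integrable M (\<lambda>\<omega>. \<Sum>i\<le>k. \<bar>weighted_sum m (\<lambda>j. \<xi> j \<omega>) i\<bar>)"
    using assms by (intro Bochner_Integration.integrable_sum integrable_abs integrable_weighted_sum) auto
  show "AE \<omega> in M. norm (running_max (weighted_sum m (\<lambda>j. \<xi> j \<omega>)) k)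
          \<le> norm (\<Sum>i\<le>k. \<bar>weighted_sum m (\<lambda>j. \<xi> j \<omega>) i\<bar>)"
    using running_max_le_sum running_max_nonneg
    by (intro AE_I2) (simp add: abs_of_nonneg sum_nonneg)
qed (use assms in \<open>rule running_max_random_variable\<close>)

lemma weighted_sum_second_moment:
  assumes "k \<le> N"
  shows "integrable M (\<lambda>\<omega>. (weighted_sum m (\<lambda>j. \<xi> j \<omega>) k)\<^sup>2)"
    and "expectation (\<lambda>\<omega>. (weighted_sum m (\<lambda>j. \<xi> j \<omega>) k)\<^sup>2)
           \<le> s * (\<Sum>j<k. 1 / (real (max (Suc j) m))\<^sup>2)"
proof -
  have "integrable M (\<lambda>\<omega>. (weighted_sum m (\<lambda>j. \<xi> j \<omega>) k)\<^sup>2) \<and>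
    expectation (\<lambda>\<omega>. (weighted_sum m (\<lambda>j. \<xi> j \<omega>) k)\<^sup>2)
           \<le> s * (\<Sum>j<k. 1 / (real (max (Suc j) m))\<^sup>2)"
    using assms
  proof (induction k)
    case (Suc k)
    let ?U = "\<lambda>\<omega>. weighted_sum m (\<lambda>j. \<xi> j \<omega>) k" and ?c = "real (max (Suc k) m)"
    have k: "k < N" using Suc by auto
    have orth: "integrable M (\<lambda>\<omega>. ?U \<omega> * \<xi> k \<omega>)" "expectation (\<lambda>\<omega>. ?U \<omega> * \<xi> k \<omega>) = 0"
      by (rule indep_vars_prefix_orthogonal[OF ind k, where g = "\<lambda>x. weighted_sum m x k"];
          use k in \<open>auto intro!: measurable_weighted_sum integrable_weighted_sum indep_seq_integrable mean weighted_sum_cong\<close>)+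
    have eq: "(weighted_sum m (\<lambda>j. \<xi> j \<omega>) (Suc k))\<^sup>2
        = (?U \<omega>)\<^sup>2 + 2 / ?c * (?U \<omega> * \<xi> k \<omega>) + 1 / ?c\<^sup>2 * (\<xi> k \<omega>)\<^sup>2" for \<omega>
      by (simp add: weighted_sum_Suc power2_eq_square field_simps)
    have IH: "integrable M (\<lambda>\<omega>. (?U \<omega>)\<^sup>2)"
       "expectation (\<lambda>\<omega>. (?U \<omega>)\<^sup>2) \<le> s * (\<Sum>j<k. 1 / (real (max (Suc j) m))\<^sup>2)"
      using Suc by auto
    have "expectation (\<lambda>\<omega>. (weighted_sum m (\<lambda>j. \<xi> j \<omega>) (Suc k))\<^sup>2)
        = expectation (\<lambda>\<omega>. (?U \<omega>)\<^sup>2) + 1 / ?c\<^sup>2 * expectation (\<lambda>\<omega>. (\<xi> k \<omega>)\<^sup>2)"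
      unfolding eq using IH orth sq[OF k] by simp
    also have "\<dots> \<le> s * (\<Sum>j<k. 1 / (real (max (Suc j) m))\<^sup>2) + 1 / ?c\<^sup>2 * s"
      using IH var[OF k] by (intro add_mono mult_left_mono) auto
    finally have "expectation (\<lambda>\<omega>. (weighted_sum m (\<lambda>j. \<xi> j \<omega>) (Suc k))\<^sup>2)
      \<le> s * (\<Sum>j<Suc k. 1 / (real (max (Suc j) m))\<^sup>2)"
      by (simp add: algebra_simps)
    moreover have "integrable M (\<lambda>\<omega>. (weighted_sum m (\<lambda>j. \<xi> j \<omega>) (Suc k))\<^sup>2)"
      unfolding eq using IH orth sq[OF k]
      by (intro Bochner_Integration.integrable_add integrable_mult_right) auto
    ultimately show ?case by blast
  qed auto
  then show "integrable M (\<lambda>\<omega>. (weighted_sum m (\<lambda>j. \<xi> j \<omega>) k)\<^sup>2)"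
    "expectation (\<lambda>\<omega>. (weighted_sum m (\<lambda>j. \<xi> j \<omega>) k)\<^sup>2)
           \<le> s * (\<Sum>j<k. 1 / (real (max (Suc j) m))\<^sup>2)" by auto
qed

text \<open>The expectation of \<open>running_max_doob\<close>: the value of the running maximum
  before step \<open>j\<close> depends only on earlier noise, so the sum there has mean zero. The
  constant is 4 from Doob times 2 from \<open>sum_inverse_squares_max\<close>.\<close>

lemma running_max_second_moment:
  assumes "0 < m" "0 \<le> s"
  shows "integrable M (\<lambda>\<omega>. (running_max (weighted_sum m (\<lambda>j. \<xi> j \<omega>)) N)\<^sup>2)"
    and "expectation (\<lambda>\<omega>. (running_max (weighted_sum m (\<lambda>j. \<xi> j \<omega>)) N)\<^sup>2) \<le> 8 * s / real m"
proof -
  let ?U = "\<lambda>\<omega>. weighted_sum m (\<lambda>j. \<xi> j \<omega>)"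
  define D where "D \<omega> = 4 * (?U \<omega> N)\<^sup>2
    - 4 * (\<Sum>j<N. running_max (?U \<omega>) j * \<xi> j \<omega> / real (max (Suc j) m))" for \<omega>
  have le: "(running_max (?U \<omega>) N)\<^sup>2 \<le> D \<omega>" for \<omega>
    using running_max_doob[of "?U \<omega>" N] by (simp add: D_def weighted_sum_Suc)
  have orth: "integrable M (\<lambda>\<omega>. running_max (?U \<omega>) j * \<xi> j \<omega>)"
             "expectation (\<lambda>\<omega>. running_max (?U \<omega>) j * \<xi> j \<omega>) = 0" if j: "j < N" for j
    by (rule indep_vars_prefix_orthogonal[OF ind j, where g = "\<lambda>x. running_max (weighted_sum m x) j"];
        use j in \<open>auto intro!: measurable_running_max_weighted_sum integrable_running_max indep_seq_integrable mean running_max_cong weighted_sum_cong\<close>)+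
  note U2 = weighted_sum_second_moment[OF order_refl, of m]
  let ?S = "\<lambda>\<omega>. \<Sum>j<N. running_max (?U \<omega>) j * \<xi> j \<omega> / real (max (Suc j) m)"
  have sum_int: "integrable M ?S" and sum_0: "expectation ?S = 0"
    using orth by (auto simp: Bochner_Integration.integral_sum
        simp del: of_nat_max intro!: Bochner_Integration.integrable_sum)
  have D: "integrable M D"
    unfolding D_def using sum_int U2
    by (intro Bochner_Integration.integrable_diff integrable_mult_right) auto
  \<comment> \<open>So far only the first moment of the maximum is known to be finite; square
    integrability comes from the majorant \<open>D\<close>.\<close>
  show int: "integrable M (\<lambda>\<omega>. (running_max (?U \<omega>) N)\<^sup>2)"
    by (rule Bochner_Integration.integrable_bound[OF D])
       (use le in \<open>auto intro!: AE_I2 borel_measurable_power running_max_random_variable intro: order_trans[OF _ abs_ge_self]\<close>)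
  have "expectation (\<lambda>\<omega>. (running_max (?U \<omega>) N)\<^sup>2) \<le> expectation D"
    using int D le by (intro integral_mono) auto
  also have "expectation D = 4 * expectation (\<lambda>\<omega>. (?U \<omega> N)\<^sup>2)"
    unfolding D_def using U2 sum_int sum_0
    by (subst Bochner_Integration.integral_diff) auto
  also have "\<dots> \<le> 4 * (s * (2 / real m))"
    using U2(2) mult_left_mono[OF sum_inverse_squares_max[OF assms(1), of N] assms(2)] by linarith
  finally show "expectation (\<lambda>\<omega>. (running_max (?U \<omega>) N)\<^sup>2) \<le> 8 * s / real m" by simp
qed

end

text \<open>A single \<open>Z\<close> covers every admissible length, so \<open>k\<close> may later
  depend on the outcome. The constant 32 is \<open>2 * 8\<close> for each of the two running
  maxima.\<close>

lemma maximal_average_inequality: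
  fixes \<xi> :: "nat \<Rightarrow> 'a \<Rightarrow> real"
  assumes ind: "indep_vars (\<lambda>_. borel) \<xi> {..<N}"
    and sq: "\<And>j. j < N \<Longrightarrow> integrable M (\<lambda>\<omega>. (\<xi> j \<omega>)\<^sup>2)"
    and mean: "\<And>j. j < N \<Longrightarrow> expectation (\<xi> j) = 0"
    and var: "\<And>j. j < N \<Longrightarrow> expectation (\<lambda>\<omega>. (\<xi> j \<omega>)\<^sup>2) \<le> s"
    and m: "0 < m" "0 \<le> s"
  obtains Z where "integrable M Z" "expectation Z \<le> 32 * s / real m" "\<And>\<omega>. 0 \<le> Z \<omega>"
    "\<And>\<omega> k. m \<le> k \<Longrightarrow> k \<le> N \<Longrightarrow> (max 0 ((\<Sum>j<k. \<xi> j \<omega>) / real k))\<^sup>2 \<le> Z \<omega>"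
proof
  let ?R = "\<lambda>\<omega>. running_max (weighted_sum m (\<lambda>j. \<xi> j \<omega>)) N"
  let ?Q = "\<lambda>\<omega>. running_max (weighted_sum m (\<lambda>j. - \<xi> j \<omega>)) N"
  let ?Z = "\<lambda>\<omega>. 2 * (?R \<omega>)\<^sup>2 + 2 * (?Q \<omega>)\<^sup>2"
  note R = running_max_second_moment[OF ind sq mean var m]
  have "indep_vars (\<lambda>_. borel) (\<lambda>j \<omega>. - \<xi> j \<omega>) {..<N}"
    by (rule indep_vars_compose2[OF ind]) auto
  note Q = running_max_second_moment[OF this _ _ _ m]
  have Q: "integrable M (\<lambda>\<omega>. (?Q \<omega>)\<^sup>2)" "expectation (\<lambda>\<omega>. (?Q \<omega>)\<^sup>2) \<le> 8 * s / real m"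
    using sq mean var by (auto intro!: Q)
  show "integrable M ?Z" using R Q by auto
  have "expectation ?Z = 2 * expectation (\<lambda>\<omega>. (?R \<omega>)\<^sup>2) + 2 * expectation (\<lambda>\<omega>. (?Q \<omega>)\<^sup>2)"
    using R Q by simp
  then show "expectation ?Z \<le> 32 * s / real m" using R Q by simp
  show "0 \<le> ?Z \<omega>" for \<omega> by simp
  fix \<omega> k assume k: "m \<le> k" "k \<le> N"
  have "(max 0 ((\<Sum>j<k. \<xi> j \<omega>) / real k))\<^sup>2 \<le> (?R \<omega> + ?Q \<omega>)\<^sup>2"
    using average_le_running_max[OF m(1) k, of "\<lambda>j. \<xi> j \<omega>"]
      running_max_nonneg[of "weighted_sum m (\<lambda>j. \<xi> j \<omega>)" N]
      running_max_nonneg[of "weighted_sum m (\<lambda>j. - \<xi> j \<omega>)" N]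
    by (intro power_mono) auto
  also have "\<dots> \<le> ?Z \<omega>"
    using sum_squares_bound[of "?R \<omega>" "?Q \<omega>"] by (simp add: power2_sum)
  finally show "(max 0 ((\<Sum>j<k. \<xi> j \<omega>) / real k))\<^sup>2 \<le> ?Z \<omega>" .
qed

end

section \<open>Isotonic regression\<close>

text \<open>A predicate on sequences in sorted order, indifferent to values from \<open>n\<close>
  on; this form is stable under reversal and relabelling, where a chosen minimizer would not
  be.\<close>

definition isotonic_minimizer :: "nat \<Rightarrow> (nat \<Rightarrow> real) \<Rightarrow> (nat \<Rightarrow> real) \<Rightarrow> bool" where
  "isotonic_minimizer n Y g \<longleftrightarrow> antimono_on {..<n} g \<and>
     (\<forall>h. antimono_on {..<n} h \<longrightarrow> (\<Sum>i<n. (Y i - g i)\<^sup>2) \<le> (\<Sum>i<n. (Y i - h i)\<^sup>2))"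

lemma antimono_on_reflect:
  fixes f :: "nat \<Rightarrow> real"
  assumes "antimono_on {..<n} f"
  shows "antimono_on {..<n} (\<lambda>i. - f (n - Suc i))"
proof (rule monotone_onI)
  fix i j :: nat
  assume "i \<in> {..<n}" "j \<in> {..<n}" "i \<le> j"
  then show "- f (n - Suc i) \<ge> - f (n - Suc j)"
    using monotone_onD[OF assms, of "n - Suc j" "n - Suc i"] by auto
qed

text \<open>Reversal combined with negation maps the monotone cone to itself and preserves the loss.
  It turns an upper bound for the fit into a lower bound.\<close>

lemma isotonic_minimizer_reflect:
  assumes "isotonic_minimizer n Y g"
  shows "isotonic_minimizer n (\<lambda>i. - Y (n - Suc i)) (\<lambda>i. - g (n - Suc i))"
  unfolding isotonic_minimizer_def
proof (intro conjI allI impI)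
  show "antimono_on {..<n} (\<lambda>i. - g (n - Suc i))"
    using assms antimono_on_reflect by (auto simp: isotonic_minimizer_def)
  fix h :: "nat \<Rightarrow> real"
  assume h: "antimono_on {..<n} h"
  have "(\<Sum>i<n. (- Y (n - Suc i) - - g (n - Suc i))\<^sup>2) = (\<Sum>i<n. (- Y i - - g i)\<^sup>2)"
    by (rule sum.nat_diff_reindex)
  also have "\<dots> = (\<Sum>i<n. (Y i - g i)\<^sup>2)"
    by (intro sum.cong) (auto simp: power2_commute)
  also have "\<dots> \<le> (\<Sum>i<n. (Y i - - h (n - Suc i))\<^sup>2)"
    using assms antimono_on_reflect[OF h] by (auto simp: isotonic_minimizer_def)
  also have "\<dots> = (\<Sum>i<n. (Y (n - Suc i) - - h (n - Suc (n - Suc i)))\<^sup>2)"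
    by (rule sum.nat_diff_reindex[symmetric])
  also have "\<dots> = (\<Sum>i<n. (- Y (n - Suc i) - h i)\<^sup>2)"
    by (intro sum.cong) (auto simp: power2_eq_square algebra_simps)
  finally show "(\<Sum>i<n. (- Y (n - Suc i) - - g (n - Suc i))\<^sup>2)
      \<le> (\<Sum>i<n. (- Y (n - Suc i) - h i)\<^sup>2)" .
qed

text \<open>One half of the min-max formula for isotonic regression: lowering the fit on a block which
  ends where the fit drops keeps it monotone, so optimality makes the sum of the residuals over
  that block nonnegative.\<close>

lemma isotonic_minimizer_le_average:
  assumes g: "isotonic_minimizer n Y g" and i: "i < n" "v \<le> i"
  obtains k where "i < v + k" "v + k \<le> n" "real k * g i \<le> (\<Sum>j<k. Y (v + j))"
proof -
  have anti: "g j \<le> g i" if "i \<le> j" "j < n" for i j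
    using g that by (auto simp: isotonic_minimizer_def monotone_on_def)
  \<comment> \<open>\<open>u\<close> is the last position whose fitted value is at least
    \<open>g i\<close>; by monotonicity the fit is strictly smaller afterwards, so the block can be
    lowered.\<close>
  define U where "U = {j\<in>{..<n}. g i \<le> g j}"
  define u where "u = Max U"
  have U: "finite U" "i \<in> U" using i by (auto simp: U_def)
  have "u \<in> U" unfolding u_def using U by (intro Max_in) auto
  then have u: "i \<le> u" "u < n" "g i \<le> g u"
    using Max_ge[of U i] U by (auto simp: u_def U_def)
  have drop: "g j < g i" if "u < j" "j < n" for j
  proof (rule ccontr)
    assume "\<not> g j < g i"
    then have "j \<in> U" using that by (simp add: U_def)
    with Max_ge[OF U(1) this] that show False by (simp add: u_def)
  qed
  \<comment> \<open>The room below the block before it meets the next fitted value; if nothing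
    follows \<open>u\<close>, any positive number will do.\<close>
  define \<gamma> where "\<gamma> = (if Suc u < n then g u - g (Suc u) else 1)"
  have \<gamma>: "\<gamma> > 0" using drop[of "Suc u"] u by (auto simp: \<gamma>_def)
  define S where "S = (\<Sum>j\<in>{v..u}. Y j - g j)"
  define L where "L = real (card {v..u})"
  have L: "L > 0" using u i by (auto simp: L_def)
  have pert: "0 \<le> 2 * t * S + t\<^sup>2 * L" if t: "0 < t" "t \<le> \<gamma>" for t
  proof -
    define h where "h j = g j - (if j \<in> {v..u} then t else 0)" for j
    have "antimono_on {..<n} h"
    proof (rule monotone_onI)
      fix a c :: nat
      assume ac: "a \<in> {..<n}" "c \<in> {..<n}" "a \<le> c"
      show "h a \<ge> h c"
      \<comment> \<open>Order is at risk only between the lowered block and the positions after it;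
        relative to positions before \<open>v\<close> the gap widens.\<close>
      proof (cases "a \<in> {v..u} \<and> c \<notin> {v..u}")
        case True
        then have "u < c" using ac by auto
        then have "g c \<le> g (Suc u)" "\<gamma> = g u - g (Suc u)"
          using ac anti by (auto simp: \<gamma>_def)
        moreover have "g u \<le> g a" using True u by (auto intro: anti)
        ultimately show ?thesis using True t by (auto simp: h_def)
      next
        case False
        then show ?thesis using anti[of a c] ac t by (auto simp: h_def)
      qed
    qed
    then have "0 \<le> (\<Sum>i<n. (Y i - h i)\<^sup>2) - (\<Sum>i<n. (Y i - g i)\<^sup>2)"
      using g by (auto simp: isotonic_minimizer_def)
    also have "\<dots> = (\<Sum>i<n. (Y i - h i)\<^sup>2 - (Y i - g i)\<^sup>2)" by (simp add: sum_subtractf)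
    also have "\<dots> = (\<Sum>i<n. if i \<in> {v..u} then 2 * t * (Y i - g i) + t\<^sup>2 else 0)"
      by (intro sum.cong) (auto simp: h_def power2_eq_square algebra_simps)
    also have "\<dots> = (\<Sum>i\<in>{v..u}. 2 * t * (Y i - g i) + t\<^sup>2)"
      using u by (intro sum.mono_neutral_cong_right) auto
    also have "\<dots> = 2 * t * S + t\<^sup>2 * L"
      by (simp add: sum.distrib S_def L_def sum_distrib_left)
    finally show ?thesis .
  qed
  have S: "S \<ge> 0"
  proof (rule ccontr)
    assume "\<not> S \<ge> 0"
    then have neg: "S < 0" by simp
    \<comment> \<open>The minimum of the quadratic \<open>2 * t * S + t\<^sup>2 * L\<close> lies at
      \<open>- S / L\<close>; it is capped at the admissible range.\<close>
    define t where "t = min \<gamma> (- S / L)"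
    have t: "0 < t" "t \<le> \<gamma>" "t * L \<le> - S"
      using \<gamma> neg L by (auto simp: t_def min_def field_simps)
    have "t * (t * L) \<le> t * (- S)" using t by (intro mult_left_mono) auto
    then have "2 * t * S + t\<^sup>2 * L \<le> t * S" by (simp add: power2_eq_square algebra_simps)
    also have "\<dots> < 0" using t neg by (simp add: mult_pos_neg)
    finally show False using pert[OF t(1,2)] by simp
  qed
  have "L * g i \<le> (\<Sum>j\<in>{v..u}. g j)"
    unfolding L_def using u
    by (intro sum_bounded_below) (auto intro: order_trans[OF u(3)] anti)
  also have "\<dots> \<le> (\<Sum>j\<in>{v..u}. Y j)" using S by (simp add: S_def sum_subtractf)
  also have "\<dots> = (\<Sum>j<Suc u - v. Y (v + j))"
    using u i by (intro sum.reindex_bij_witness[of _ "\<lambda>j. v + j" "\<lambda>j. j - v"]) auto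
  finally show ?thesis using that[of "Suc u - v"] u i by (simp add: L_def)
qed

text \<open>\<open>isotonic_lse\<close> is a choice operator, so a minimizer must be exhibited
  before anything can be said about it. Continuity of the loss on a compact part of the cone
  provides one.\<close>

lemma isotonic_lse_minimizes:
  fixes x :: "nat \<Rightarrow> real" and \<pi> :: "nat \<Rightarrow> nat" and n :: nat
  defines "C \<equiv> {m \<in> extensional {..<n}. antimono_on {..<n} (\<lambda>i. m (\<pi> i))}"
  assumes \<pi>: "\<And>i. i < n \<Longrightarrow> \<pi> i < n"
  shows "isotonic_lse n \<pi> x \<in> C"
    and "\<And>m. m \<in> C \<Longrightarrow> (\<Sum>i<n. (x i - isotonic_lse n \<pi> x i)\<^sup>2) \<le> (\<Sum>i<n. (x i - m i)\<^sup>2)"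
proof -
  define F where "F m = (\<Sum>i<n. (x i - m i)\<^sup>2)" for m
  define z where "z = (\<lambda>i. if i < n then 0 else undefined :: real)"
  \<comment> \<open>A competitor at least as good as the zero vector \<open>z\<close> stays within
    \<open>sqrt (F z)\<close> of \<open>x\<close> in each coordinate, hence in the box of half-width
    \<open>R\<close>; all others lose against \<open>z\<close>.\<close>
  define R where "R = (\<Sum>i<n. \<bar>x i\<bar>) + sqrt (F z)"
  \<comment> \<open>Coordinates from \<open>n\<close> on range over the single point
    \<open>undefined\<close>: the infinite product is still compact, and its elements are
    extensional.\<close>
  define K where "K = (\<Pi>\<^sub>E i\<in>UNIV. if i < n then {-R..R} else {undefined::real})"
  define A where "A = (\<Inter>i\<in>{..<n}. \<Inter>j\<in>{i..<n}. {m::nat \<Rightarrow> real. m (\<pi> j) \<le> m (\<pi> i)})"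
  have "compactin (product_topology (\<lambda>_. euclidean) UNIV) K"
    unfolding K_def by (subst compactin_PiE) auto
  then have "compact K" by (simp add: euclidean_product_topology)
  moreover have "closed A"
    unfolding A_def by (intro closed_INT ballI closed_Collect_le continuous_on_product_coordinates)
  ultimately have "compact (K \<inter> A)" by (rule compact_Int_closed)
  have Fz: "F z \<ge> 0" by (auto simp: F_def intro: sum_nonneg)
  have R0: "R \<ge> 0" using Fz by (auto simp: R_def intro!: add_nonneg_nonneg sum_nonneg)
  have C: "m \<in> C \<longleftrightarrow> (\<forall>i\<ge>n. m i = undefined) \<and> m \<in> A" for m
    by (auto simp: C_def A_def extensional_def monotone_on_def not_less)
  have zC: "z \<in> C" using \<pi> by (auto simp: C z_def A_def)
  have zK: "z \<in> K" using R0 by (auto simp: K_def z_def)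
  have KC: "m \<in> C" if "m \<in> K \<inter> A" for m
  proof -
    have "m i = undefined" if "i \<ge> n" for i
      using \<open>m \<in> K \<inter> A\<close> that by (auto simp: K_def PiE_iff dest!: spec[of _ i])
    then show ?thesis using that by (auto simp: C)
  qed
  have "continuous_on (K \<inter> A) F"
    unfolding F_def
    by (intro continuous_intros continuous_on_subset[OF continuous_on_product_coordinates]) auto
  with \<open>compact (K \<inter> A)\<close> obtain m0 where m0: "m0 \<in> K \<inter> A" "\<And>m. m \<in> K \<inter> A \<Longrightarrow> F m0 \<le> F m"
    using continuous_attains_inf[of "K \<inter> A" F] zK zC by (auto simp: C)
  have min: "F m0 \<le> F m" if m: "m \<in> C" for m
  proof (cases "F m \<le> F z")
    case True
    have "\<bar>m i\<bar> \<le> R" if i: "i < n" for i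
    proof -
      have "(x i - m i)\<^sup>2 \<le> F m" unfolding F_def using i by (intro member_le_sum) auto
      then have "\<bar>x i - m i\<bar> \<le> sqrt (F z)" using True
        by (metis order_trans real_sqrt_abs real_sqrt_le_iff)
      moreover have "\<bar>x i\<bar> \<le> (\<Sum>i<n. \<bar>x i\<bar>)" using i by (intro member_le_sum) auto
      ultimately show ?thesis by (simp add: R_def)
    qed
    then have "m \<in> K" using m by (auto simp: K_def C abs_le_iff minus_le_iff)
    then show ?thesis using m m0 by (auto simp: C)
  next
    case False
    then show ?thesis using m0(2)[of z] zK zC by (auto simp: C)
  qed
  have "is_arg_min F (\<lambda>m. m \<in> C) m0"
    using KC[OF m0(1)] min by (auto simp: is_arg_min_linorder)
  then have "is_arg_min F (\<lambda>m. m \<in> C) (SOME m. is_arg_min F (\<lambda>m. m \<in> C) m)"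
    by (rule someI[of "is_arg_min F (\<lambda>m. m \<in> C)"])
  then have "is_arg_min F (\<lambda>m. m \<in> C) (isotonic_lse n \<pi> x)"
    by (simp add: isotonic_lse_def arg_min_on_def arg_min_def F_def[abs_def] C_def)
  then show "isotonic_lse n \<pi> x \<in> C"
    and "\<And>m. m \<in> C \<Longrightarrow> (\<Sum>i<n. (x i - isotonic_lse n \<pi> x i)\<^sup>2) \<le> (\<Sum>i<n. (x i - m i)\<^sup>2)"
    by (auto simp: is_arg_min_linorder F_def)
qed

lemma isotonic_lse_isotonic_minimizer:
  assumes \<pi>: "\<pi> permutes {..<n}"
  shows "isotonic_minimizer n (\<lambda>i. x (\<pi> i)) (\<lambda>i. isotonic_lse n \<pi> x (\<pi> i))"
  unfolding isotonic_minimizer_def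
proof (intro conjI allI impI)
  have \<pi>n: "\<pi> i < n" if "i < n" for i using permutes_in_image[OF \<pi>, of i] that by simp
  note lse = isotonic_lse_minimizes[where n = n and \<pi> = \<pi> and x = x]
  show "antimono_on {..<n} (\<lambda>i. isotonic_lse n \<pi> x (\<pi> i))" using lse(1) \<pi>n by simp
  fix h :: "nat \<Rightarrow> real"
  assume h: "antimono_on {..<n} h"
  \<comment> \<open>The competitor \<open>h\<close>, given in sorted order, is carried back to the
    original labels.\<close>
  define m where "m i = (if i < n then h (inv \<pi> i) else undefined)" for i
  have m: "m (\<pi> i) = h i" if "i < n" for i
    using that \<pi>n by (simp add: m_def permutes_inverses[OF \<pi>])
  have perm: "(\<Sum>i<n. G (\<pi> i)) = (\<Sum>i<n. G i)" for G :: "nat \<Rightarrow> real"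
    using sum.permute[OF \<pi>, of G] by (simp add: o_def)
  have "antimono_on {..<n} (\<lambda>i. m (\<pi> i))"
    using h m by (auto simp: monotone_on_def)
  moreover have "m \<in> extensional {..<n}" by (auto simp: m_def extensional_def)
  ultimately have "(\<Sum>i<n. (x i - isotonic_lse n \<pi> x i)\<^sup>2) \<le> (\<Sum>i<n. (x i - m i)\<^sup>2)"
    using lse(2) \<pi>n by blast
  also have "\<dots> = (\<Sum>i<n. (x (\<pi> i) - m (\<pi> i))\<^sup>2)" by (rule perm[symmetric])
  also have "\<dots> = (\<Sum>i<n. (x (\<pi> i) - h i)\<^sup>2)" by (intro sum.cong) (auto simp: m)
  finally show "(\<Sum>i<n. (x (\<pi> i) - isotonic_lse n \<pi> x (\<pi> i))\<^sup>2) \<le> (\<Sum>i<n. (x (\<pi> i) - h i)\<^sup>2)"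
    by (subst perm)
qed

section \<open>Window lengths that balance bias and noise\<close>

lemma sum_inverse_sqrt_le: "(\<Sum>k<K. 1 / sqrt (real (Suc k))) \<le> 2 * sqrt (real K)"
proof (induction K)
  case (Suc K)
  have "(sqrt (real (Suc K)) - sqrt (real K)) * (sqrt (real (Suc K)) + sqrt (real K)) = 1"
    by (simp add: algebra_simps)
  moreover have "sqrt (real (Suc K)) + sqrt (real K) \<le> 2 * sqrt (real (Suc K))" by simp
  moreover have "0 \<le> sqrt (real (Suc K)) - sqrt (real K)" by simp
  ultimately have "1 \<le> (sqrt (real (Suc K)) - sqrt (real K)) * (2 * sqrt (real (Suc K)))"
    by (metis mult_left_mono)
  then have "1 / sqrt (real (Suc K)) \<le> 2 * (sqrt (real (Suc K)) - sqrt (real K))"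
    by (simp add: divide_simps algebra_simps)
  with Suc show ?case by simp
qed auto

lemma sum_inverse_le_ln:
  assumes "n \<ge> 2"
  shows "(\<Sum>i<n. 1 / real (Suc i)) \<le> 3 * ln (real n)"
proof -
  have "(\<Sum>i<n. 1 / real (Suc i)) \<le> 1 + ln (real n)" if "n \<ge> 1" for n
    using that
  proof (induction n rule: dec_induct)
    case (step n)
    have "1 / real (Suc n) \<le> - ln (1 - 1 / real (Suc n))"
      using ln_le_minus_one[of "1 - 1 / real (Suc n)"] step by (simp add: field_simps)
    also have "\<dots> = ln (real (Suc n)) - ln (real n)"
    proof -
      have "1 - 1 / real (Suc n) = real n / real (Suc n)" by (simp add: field_simps)
      then show ?thesis using step by (simp add: ln_div)
    qed
    finally show ?case using step by simp
  qed auto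
  \<comment> \<open>From \<open>n \<ge> 2\<close> on, the additive 1 of the harmonic sum can be
    absorbed into the logarithm.\<close>
  moreover have "1 \<le> 2 * ln (real n)"
  proof -
    have "1 \<le> 2 * ln (2::real)" using ln2_ge_two_thirds by simp
    also have "\<dots> \<le> 2 * ln (real n)" using assms by simp
    finally show ?thesis .
  qed
  ultimately show ?thesis using assms by (smt (verit) One_nat_def Suc_leD numeral_2_eq_2)
qed

text \<open>The window \<open>m i\<close> is the longest one ending at \<open>i\<close> whose bias does not exceed the noise level
  \<open>s / sqrt (m i)\<close>.  A window which stops before the boundary and is shorter than \<open>1 / q\<close> is paid
  for by the drop of \<open>f\<close> just beyond it.\<close>

lemma bias_variance_windows:
  fixes f :: "nat \<Rightarrow> real"
  assumes n: "n \<ge> 2" and s: "s > 0" and V: "V > 0"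
    and anti: "antimono_on {..<n} f" and fV: "f 0 - f (n - 1) \<le> V"
  obtains m where "\<And>i. i < n \<Longrightarrow> 1 \<le> m i \<and> m i \<le> Suc i \<and> f (Suc i - m i) - f i \<le> s / sqrt (real (m i))"
    "(\<Sum>i<n. 1 / real (m i)) \<le> 4 * real n * min 1 ((V / (real n * s)) powr (2 / 3) + ln (real n) / real n)"
proof -
  define S where "S i = {k\<in>{1..Suc i}. f (Suc i - k) - f i \<le> s / sqrt (real k)}" for i
  define m where "m i = Max (S i)" for i
  have S: "finite (S i)" "1 \<in> S i" for i using s by (auto simp: S_def)
  have mS: "m i \<in> S i" for i unfolding m_def using S[of i] by (intro Max_in) auto
  have m: "1 \<le> m i" "m i \<le> Suc i" "f (Suc i - m i) - f i \<le> s / sqrt (real (m i))" for i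
    using mS[of i] by (auto simp: S_def)
  \<comment> \<open>By maximality, the window that is longer by one and starts at
    \<open>i - m i\<close> already has too much bias.\<close>
  have stop: "s / sqrt (real (Suc (m i))) < f (i - m i) - f i" if "m i \<le> i" for i
  proof (rule ccontr)
    assume "\<not> ?thesis"
    then have "Suc (m i) \<in> S i" using that by (auto simp: S_def not_less)
    from Max_ge[OF S(1) this] show False by (simp add: m_def)
  qed
  have fmono: "f j \<le> f i" if "i \<le> j" "j < n" for i j
    using anti that by (auto simp: monotone_on_def)
  \<comment> \<open>\<open>q\<close> is the target cost per position; its defining property is the
    balance \<open>wq\<close> below.\<close>
  define w where "w = V / (real n * s)"
  define q where "q = w powr (2 / 3)"
  have w: "w > 0" using V s n by (auto simp: w_def)
  have q: "q > 0" using w by (simp add: q_def)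
  define B where "B = {k. k < n \<and> real (Suc k) < 1 / q}"
  \<comment> \<open>The drop of \<open>f\<close> over the single step at lag \<open>k\<close> before
    \<open>i\<close>, set to 0 where this step would leave the range.\<close>
  define d where "d k i = (if k < i then f (i - Suc k) - f (i - k) else 0)" for k i
  have d0: "d k i \<ge> 0" if "i < n" for k i using that by (auto simp: d_def intro: fmono)
  have pw: "1 / real (m i) \<le> q + 1 / real (Suc i) + sqrt 2 / s * (\<Sum>k\<in>B. d k i / sqrt (real (Suc k)))"
    if i: "i < n" for i
  proof -
    have sum0: "0 \<le> (\<Sum>k\<in>B. d k i / sqrt (real (Suc k)))" using d0[OF i] by (intro sum_nonneg) auto
    consider "real (m i) \<ge> 1 / q" | "m i = Suc i" | "real (m i) < 1 / q" "m i \<le> i"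
      using m(2)[of i] by linarith
    then show ?thesis
    proof cases
      case 1
      then have "1 / real (m i) \<le> q" using q m(1)[of i] by (simp add: field_simps)
      then show ?thesis using sum0 s by (smt (verit) divide_nonneg_pos mult_nonneg_nonneg of_nat_0_le_iff of_nat_0_less_iff real_sqrt_ge_zero zero_less_Suc)
    next
      case 2
      then show ?thesis using sum0 s q by (smt (verit) divide_nonneg_pos mult_nonneg_nonneg real_sqrt_ge_zero)
    next
      case 3
      let ?r = "sqrt (real (m i))"
      have r: "?r > 0" "?r * ?r = real (m i)" using m(1)[of i] by auto
      have tel: "(\<Sum>k<M. d k i) = f (i - M) - f i" if "M \<le> i" for M
        using that by (induction M) (auto simp: d_def)
      have "sqrt (real (Suc (m i))) \<le> sqrt 2 * ?r"
        using m(1)[of i] by (subst real_sqrt_mult[symmetric]) (rule real_sqrt_le_mono, auto)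
      then have "s / (sqrt 2 * ?r) \<le> s / sqrt (real (Suc (m i)))"
        using s r by (intro divide_left_mono) auto
      also have "\<dots> \<le> f (i - m i) - f i" using stop[OF 3(2)] by simp
      also have "\<dots> = (\<Sum>k<m i. d k i)" using tel[OF 3(2)] by simp
      finally have "s / (sqrt 2 * ?r) / ?r \<le> (\<Sum>k<m i. d k i) / ?r"
        using r by (intro divide_right_mono) auto
      \<comment> \<open>Replacing \<open>m i\<close> by the smaller \<open>Suc k\<close> under the
        root removes the dependence of the weight on \<open>i\<close>; this is what makes the
        interchange of the sums over \<open>i\<close> and \<open>k\<close> profitable.\<close>
      also have "\<dots> \<le> (\<Sum>k<m i. d k i / sqrt (real (Suc k)))"
        unfolding sum_divide_distrib using d0[OF i] by (intro sum_mono divide_left_mono) auto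
      also have "\<dots> \<le> (\<Sum>k\<in>B. d k i / sqrt (real (Suc k)))"
        using 3 i d0[OF i] by (intro sum_mono2) (auto simp: B_def)
      finally have "s / (sqrt 2 * real (m i)) \<le> (\<Sum>k\<in>B. d k i / sqrt (real (Suc k)))"
        using r(2) by (simp add: mult.assoc)
      then have "sqrt 2 / s * (s / (sqrt 2 * real (m i))) \<le> sqrt 2 / s * (\<Sum>k\<in>B. d k i / sqrt (real (Suc k)))"
        using s by (intro mult_left_mono) auto
      then have "1 / real (m i) \<le> sqrt 2 / s * (\<Sum>k\<in>B. d k i / sqrt (real (Suc k)))"
        using s by simp
      moreover have "0 \<le> 1 / real (Suc i)" by simp
      ultimately show ?thesis using q by linarith
    qed
  qed
  \<comment> \<open>At a fixed lag the drops telescope in \<open>i\<close>.\<close>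
  have dsum: "(\<Sum>i<n. d k i) \<le> V" if "k < n" for k
  proof -
    have tel: "(\<Sum>i<M. d k i) = f 0 - f (M - Suc k)" if "M > k" for M
      using that
    proof (induction M)
      case (Suc M)
      show ?case
      proof (cases "M = k")
        case True
        have "(\<Sum>i<M. d k i) = 0" using True by (intro sum.neutral) (auto simp: d_def)
        then show ?thesis using True by (simp add: d_def)
      next
        case False
        then show ?thesis using Suc by (simp add: d_def)
      qed
    qed auto
    have "f (n - 1) \<le> f (n - Suc k)" using that by (intro fmono) auto
    then show ?thesis using tel[OF that] fV by simp
  qed
  \<comment> \<open>The number of positive integers strictly below \<open>1 / q\<close>, so that
    \<open>B\<close> lies in an initial segment of length at most \<open>1 / q\<close>.\<close>
  define K where "K = nat (\<lceil>1 / q\<rceil> - 1)"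
  have KB: "B \<subseteq> {..<K}"
  proof
    fix k assume "k \<in> B"
    then have "real (Suc k) < 1 / q" by (simp add: B_def)
    then have "int (Suc k) < \<lceil>1 / q\<rceil>" by (simp add: less_ceiling_iff)
    then show "k \<in> {..<K}" by (simp add: K_def)
  qed
  have "0 < 1 / q" using q by simp
  then have "0 < \<lceil>1 / q\<rceil>" by (simp only: zero_less_ceiling)
  then have "real K = of_int \<lceil>1 / q\<rceil> - 1" by (simp add: K_def)
  then have K: "real K \<le> 1 / q" using ceiling_correct[of "1 / q"] by linarith
  have wq: "w * sqrt (1 / q) = q"
  proof -
    have "sqrt (1 / q) = w powr (- (1 / 3))"
      using w by (simp add: q_def powr_minus_divide real_sqrt_divide flip: powr_half_sqrt) (simp add: powr_powr)
    then show ?thesis using w by (simp add: q_def powr_mult_base)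
  qed
  have "(\<Sum>i<n. \<Sum>k\<in>B. d k i / sqrt (real (Suc k))) = (\<Sum>k\<in>B. (\<Sum>i<n. d k i) / sqrt (real (Suc k)))"
    by (subst sum.swap) (simp add: sum_divide_distrib)
  also have "\<dots> \<le> (\<Sum>k\<in>B. V * (1 / sqrt (real (Suc k))))"
    using dsum by (intro sum_mono) (auto simp: B_def intro!: divide_right_mono)
  also have "\<dots> \<le> (\<Sum>k<K. V * (1 / sqrt (real (Suc k))))"
    using V KB by (intro sum_mono2) auto
  also have "\<dots> = V * (\<Sum>k<K. 1 / sqrt (real (Suc k)))" by (rule sum_distrib_left[symmetric])
  also have "\<dots> \<le> V * (2 * sqrt (1 / q))"
    using V sum_inverse_sqrt_le[of K] K
    by (intro mult_left_mono) (auto intro: order_trans)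
  finally have dB: "(\<Sum>i<n. \<Sum>k\<in>B. d k i / sqrt (real (Suc k))) \<le> V * (2 * sqrt (1 / q))" .
  have "(\<Sum>i<n. 1 / real (m i)) \<le> (\<Sum>i<n. q + 1 / real (Suc i)
          + sqrt 2 / s * (\<Sum>k\<in>B. d k i / sqrt (real (Suc k))))"
    using pw by (intro sum_mono) auto
  also have "\<dots> = real n * q + (\<Sum>i<n. 1 / real (Suc i))
      + sqrt 2 / s * (\<Sum>i<n. \<Sum>k\<in>B. d k i / sqrt (real (Suc k)))"
    by (simp add: sum.distrib sum_distrib_left)
  also have "\<dots> \<le> real n * q + 3 * ln (real n) + sqrt 2 / s * (V * (2 * sqrt (1 / q)))"
    using dB s sum_inverse_le_ln[OF n] by (intro add_mono mult_left_mono) auto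
  \<comment> \<open>Here \<open>V = w * n * s\<close> and the balance \<open>wq\<close> enter. With
    \<open>2 * sqrt 2 \<le> 3\<close> the charged drops cost \<open>3 * n * q\<close>, which with
    the \<open>n * q\<close> of the long windows gives the constant 4.\<close>
  also have "sqrt 2 / s * (V * (2 * sqrt (1 / q))) = 2 * sqrt 2 * real n * q"
    using s n by (subst (2) wq[symmetric]) (simp add: w_def)
  also have "\<dots> \<le> 3 * real n * q"
    using q real_le_lsqrt[of "3 / 2" 2]
    by (intro mult_right_mono) (auto simp: power2_eq_square)
  finally have "(\<Sum>i<n. 1 / real (m i)) \<le> 4 * real n * q + 3 * ln (real n)"
    by (simp add: algebra_simps)
  moreover have "0 \<le> ln (real n)" using n by simp
  ultimately have "(\<Sum>i<n. 1 / real (m i)) \<le> 4 * real n * q + 4 * ln (real n)" by linarith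
  moreover have "(\<Sum>i<n. 1 / real (m i)) \<le> (\<Sum>i<n. 1)"
    using m(1) by (intro sum_mono) (simp add: Suc_le_eq)
  moreover have "4 * real n * q + 4 * ln (real n) = 4 * real n * (q + ln (real n) / real n)"
    using n by (simp add: field_simps)
  ultimately have "(\<Sum>i<n. 1 / real (m i)) \<le> 4 * real n * min 1 (q + ln (real n) / real n)"
    using n unfolding min_def by (simp del: of_nat_Suc)
  then show ?thesis using that[of m] m by (auto simp: q_def w_def)
qed

text \<open>Injectivity lets an event generated by \<open>X (h j)\<close> be indexed by
  \<open>j\<close> as well as by \<open>h j\<close>. Applied to the shift to the start of a window,
  to the reversal of the order and to the sorting permutation.\<close>

lemma (in prob_space) indep_vars_reindex:
  assumes inj: "inj_on h J" and ind: "indep_vars M' X (h ` J)"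
  shows "indep_vars (\<lambda>j. M' (h j)) (\<lambda>j. X (h j)) J"
  unfolding indep_vars_def
proof (intro conjI ballI indep_setsI)
  let ?F = "\<lambda>i. sigma_sets (space M) {X i -` A \<inter> space M |A. A \<in> sets (M' i)}"
  have sets: "indep_sets ?F (h ` J)" using ind by (simp add: indep_vars_def)
  show "random_variable (M' (h j)) (X (h j))" if "j \<in> J" for j
    using ind that by (simp add: indep_vars_def)
  show "?F (h j) \<subseteq> events" if "j \<in> J" for j
    using sets that by (simp add: indep_sets_def)
  fix A and K
  assume K: "K \<noteq> {}" "K \<subseteq> J" "finite K" "\<forall>j\<in>K. A j \<in> ?F (h j)"
  define B where "B i = A (the_inv_into J h i)" for i
  have B: "B (h j) = A j" if "j \<in> K" for j
    using the_inv_into_f_f[OF inj, of j] that K by (auto simp: B_def)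
  have "prob (\<Inter>i\<in>h ` K. B i) = (\<Prod>i\<in>h ` K. prob (B i))"
    using K B by (intro indep_setsD[OF sets]) auto
  then show "prob (\<Inter>j\<in>K. A j) = (\<Prod>j\<in>K. prob (A j))"
    using B by (simp add: prod.reindex[OF inj_on_subset[OF inj K(2)]])
qed

lemma indep_vars_PiM_components:
  fixes N :: "'i \<Rightarrow> 'b measure"
  assumes N: "\<And>i. i \<in> I \<Longrightarrow> prob_space (N i)" and I: "finite I" "I \<noteq> {}"
  shows "prob_space.indep_vars (PiM I N) N (\<lambda>i x. x i) I"
proof -
  interpret P: prob_space "PiM I N" using N by (rule prob_space_PiM)
  have "distr (PiM I N) (PiM I N) (\<lambda>x. \<lambda>i\<in>I. x i) = distr (PiM I N) (PiM I N) (\<lambda>x. x)"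
    by (intro distr_cong) (auto simp: space_PiM)
  also have "\<dots> = PiM I N" by simp
  also have "\<dots> = (\<Pi>\<^sub>M i\<in>I. distr (PiM I N) (N i) (\<lambda>x. x i))"
    using I N by (intro PiM_cong) (auto simp: distr_PiM_component)
  finally show ?thesis
    using I by (subst P.indep_vars_iff_distr_eq_PiM') auto
qed

section \<open>Risk of the isotonic fit under independent centred noise\<close>

context prob_space
begin

text \<open>The start of the window for \<open>i\<close> is determined by \<open>f\<close> alone, so
  one majorant per position suffices although the end of the block is random. Bias and noise
  contribute 2 and \<open>2 * 32\<close> to the factor 66 of \<open>s^2 / m i\<close>; the sum over
  windows contributes 4.\<close>

lemma isotonic_one_sided_risk:
  fixes \<epsilon> :: "nat \<Rightarrow> 'a \<Rightarrow> real" and f :: "nat \<Rightarrow> real" and g :: "'a \<Rightarrow> nat \<Rightarrow> real"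
  assumes n: "n \<ge> 2" and s: "s > 0" and V: "V > 0"
    and ind: "indep_vars (\<lambda>_. borel) \<epsilon> {..<n}"
    and sq: "\<And>j. j < n \<Longrightarrow> integrable M (\<lambda>\<omega>. (\<epsilon> j \<omega>)\<^sup>2)"
    and mean: "\<And>j. j < n \<Longrightarrow> expectation (\<epsilon> j) = 0"
    and var: "\<And>j. j < n \<Longrightarrow> expectation (\<lambda>\<omega>. (\<epsilon> j \<omega>)\<^sup>2) \<le> s\<^sup>2"
    and anti: "antimono_on {..<n} f" and fV: "f 0 - f (n - 1) \<le> V"
    and g: "\<And>\<omega>. isotonic_minimizer n (\<lambda>i. f i + \<epsilon> i \<omega>) (g \<omega>)"
  obtains Z where "integrable M Z" "\<And>\<omega>. 0 \<le> Z \<omega>"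
    "\<And>\<omega>. (\<Sum>i<n. (max 0 (g \<omega> i - f i))\<^sup>2) \<le> Z \<omega>"
    "expectation Z \<le> 264 * real n * s\<^sup>2 * min 1 ((V / (real n * s)) powr (2 / 3) + ln (real n) / real n)"
proof -
  obtain m where m: "\<And>i. i < n \<Longrightarrow> 1 \<le> m i \<and> m i \<le> Suc i \<and> f (Suc i - m i) - f i \<le> s / sqrt (real (m i))"
    and m_sum: "(\<Sum>i<n. 1 / real (m i)) \<le> 4 * real n * min 1 ((V / (real n * s)) powr (2 / 3) + ln (real n) / real n)"
    using bias_variance_windows[OF n s V anti fV] by blast
  have "\<forall>i\<in>{..<n}. \<exists>Z. integrable M Z \<and> expectation Z \<le> 32 * s\<^sup>2 / real (m i) \<and> (\<forall>\<omega>. 0 \<le> Z \<omega>) \<and>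
      (\<forall>\<omega>. (max 0 (g \<omega> i - f i))\<^sup>2 \<le> 2 * (s\<^sup>2 / real (m i)) + 2 * Z \<omega>)"
  proof
    fix i assume "i \<in> {..<n}"
    then have i: "i < n" by simp
    \<comment> \<open>The start of the window of length \<open>m i\<close> ending at
      \<open>i\<close>: every block from \<open>v\<close> that reaches \<open>i\<close> has length
      at least \<open>m i\<close>, as the maximal inequality requires.\<close>
    define v where "v = Suc i - m i"
    have v: "v \<le> i" "i < v + m i" "v + m i = Suc i" using m[OF i] by (auto simp: v_def)
    have "indep_vars (\<lambda>_. borel) \<epsilon> ((\<lambda>j. v + j) ` {..<n - v})"
      by (rule indep_vars_subset[OF ind]) (use v i in auto)
    from indep_vars_reindex[OF _ this]
    have "indep_vars (\<lambda>_. borel) (\<lambda>j. \<epsilon> (v + j)) {..<n - v}" by (auto simp: inj_on_def)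
    then obtain Z where Z: "integrable M Z" "expectation Z \<le> 32 * s\<^sup>2 / real (m i)" "\<And>\<omega>. 0 \<le> Z \<omega>"
      "\<And>\<omega> k. m i \<le> k \<Longrightarrow> k \<le> n - v \<Longrightarrow> (max 0 ((\<Sum>j<k. \<epsilon> (v + j) \<omega>) / real k))\<^sup>2 \<le> Z \<omega>"
      by (rule maximal_average_inequality[where m = "m i" and s = "s\<^sup>2"])
         (use sq mean var m[OF i] in auto)
    have "(max 0 (g \<omega> i - f i))\<^sup>2 \<le> 2 * (s\<^sup>2 / real (m i)) + 2 * Z \<omega>" for \<omega>
    proof -
      obtain k where k: "i < v + k" "v + k \<le> n"
        and le: "real k * g \<omega> i \<le> (\<Sum>j<k. f (v + j) + \<epsilon> (v + j) \<omega>)"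
        using isotonic_minimizer_le_average[OF g i v(1)] by blast
      define E where "E = (\<Sum>j<k. \<epsilon> (v + j) \<omega>) / real k"
      have k0: "real k > 0" using k v by auto
      \<comment> \<open>However far the block extends, monotonicity bounds the signal on it by its
        first value, so the bias does not depend on the random end.\<close>
      have "f (v + j) \<le> f v" if "j < k" for j
        using anti k v i that by (auto simp: monotone_on_def)
      then have "(\<Sum>j<k. f (v + j)) \<le> real k * f v"
        using sum_bounded_above[of "{..<k}" "\<lambda>j. f (v + j)" "f v"] by simp
      then have "real k * g \<omega> i \<le> real k * (f v + E)"
        using le k0 by (simp add: sum.distrib E_def distrib_left)
      then have "g \<omega> i \<le> f v + E" using k0 by simp
      then have "max 0 (g \<omega> i - f i) \<le> s / sqrt (real (m i)) + max 0 E"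
        using m[OF i] s by (auto simp: v_def max_def)
      then have "(max 0 (g \<omega> i - f i))\<^sup>2 \<le> (s / sqrt (real (m i)) + max 0 E)\<^sup>2"
        by (intro power_mono) auto
      also have "\<dots> \<le> 2 * (s / sqrt (real (m i)))\<^sup>2 + 2 * (max 0 E)\<^sup>2"
        using sum_squares_bound[of "s / sqrt (real (m i))" "max 0 E"] by (simp add: power2_sum)
      also have "(s / sqrt (real (m i)))\<^sup>2 = s\<^sup>2 / real (m i)" by (simp add: power_divide)
      also have "(max 0 E)\<^sup>2 \<le> Z \<omega>" unfolding E_def using k v by (intro Z(4)) auto
      finally show ?thesis by simp
    qed
    with Z show "\<exists>Z. integrable M Z \<and> expectation Z \<le> 32 * s\<^sup>2 / real (m i) \<and> (\<forall>\<omega>. 0 \<le> Z \<omega>) \<and>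
      (\<forall>\<omega>. (max 0 (g \<omega> i - f i))\<^sup>2 \<le> 2 * (s\<^sup>2 / real (m i)) + 2 * Z \<omega>)" by blast
  qed
  from bchoice[OF this] obtain Z where Z: "\<And>i. i < n \<Longrightarrow> integrable M (Z i)"
     "\<And>i. i < n \<Longrightarrow> expectation (Z i) \<le> 32 * s\<^sup>2 / real (m i)" "\<And>i \<omega>. i < n \<Longrightarrow> 0 \<le> Z i \<omega>"
     "\<And>i \<omega>. i < n \<Longrightarrow> (max 0 (g \<omega> i - f i))\<^sup>2 \<le> 2 * (s\<^sup>2 / real (m i)) + 2 * Z i \<omega>"
    by (auto simp: Ball_def)
  show ?thesis
  proof (rule that)
    let ?Z = "\<lambda>\<omega>. \<Sum>i<n. 2 * (s\<^sup>2 / real (m i)) + 2 * Z i \<omega>"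
    show "integrable M ?Z" using Z(1) by (intro Bochner_Integration.integrable_sum) auto
    show "(\<Sum>i<n. (max 0 (g \<omega> i - f i))\<^sup>2) \<le> ?Z \<omega>" for \<omega>
      using Z(4) by (intro sum_mono) auto
    then show "0 \<le> ?Z \<omega>" for \<omega> using Z(3) by (intro sum_nonneg) auto
    have "expectation ?Z = (\<Sum>i<n. 2 * (s\<^sup>2 / real (m i)) + 2 * expectation (Z i))"
      using Z(1) by (subst Bochner_Integration.integral_sum) (auto simp: prob_space)
    also have "\<dots> \<le> (\<Sum>i<n. 66 * s\<^sup>2 * (1 / real (m i)))"
    proof (rule sum_mono)
      fix i assume "i \<in> {..<n}"
      then show "2 * (s\<^sup>2 / real (m i)) + 2 * expectation (Z i) \<le> 66 * s\<^sup>2 * (1 / real (m i))"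
        using Z(2)[of i] by simp
    qed
    also have "\<dots> = 66 * s\<^sup>2 * (\<Sum>i<n. 1 / real (m i))" by (rule sum_distrib_left[symmetric])
    also have "\<dots> \<le> 66 * s\<^sup>2 * (4 * real n * min 1 ((V / (real n * s)) powr (2 / 3) + ln (real n) / real n))"
      using m_sum by (intro mult_left_mono) auto
    finally show "expectation ?Z \<le> 264 * real n * s\<^sup>2 * min 1 ((V / (real n * s)) powr (2 / 3) + ln (real n) / real n)"
      by (simp add: mult_ac)
  qed
qed

text \<open>The error splits into its positive and negative parts; the negative part is the positive
  part of the reversed and negated problem, so the constant doubles.\<close>

lemma isotonic_risk:
  fixes \<epsilon> :: "nat \<Rightarrow> 'a \<Rightarrow> real" and f :: "nat \<Rightarrow> real" and g :: "'a \<Rightarrow> nat \<Rightarrow> real"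
  assumes n: "n \<ge> 2" and s: "s > 0" and V: "V > 0"
    and ind: "indep_vars (\<lambda>_. borel) \<epsilon> {..<n}"
    and sq: "\<And>j. j < n \<Longrightarrow> integrable M (\<lambda>\<omega>. (\<epsilon> j \<omega>)\<^sup>2)"
    and mean: "\<And>j. j < n \<Longrightarrow> expectation (\<epsilon> j) = 0"
    and var: "\<And>j. j < n \<Longrightarrow> expectation (\<lambda>\<omega>. (\<epsilon> j \<omega>)\<^sup>2) \<le> s\<^sup>2"
    and anti: "antimono_on {..<n} f" and fV: "f 0 - f (n - 1) \<le> V"
    and g: "\<And>\<omega>. isotonic_minimizer n (\<lambda>i. f i + \<epsilon> i \<omega>) (g \<omega>)"
  shows "(\<integral>\<^sup>+\<omega>. ennreal (\<Sum>i<n. (g \<omega> i - f i)\<^sup>2) \<partial>M)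
    \<le> ennreal (528 * real n * s\<^sup>2 * min 1 ((V / (real n * s)) powr (2 / 3) + ln (real n) / real n))"
proof -
  let ?B = "real n * s\<^sup>2 * min 1 ((V / (real n * s)) powr (2 / 3) + ln (real n) / real n)"
  let ?r = "\<lambda>i. n - Suc i"
  obtain Z where Z: "integrable M Z" "\<And>\<omega>. 0 \<le> Z \<omega>"
    "\<And>\<omega>. (\<Sum>i<n. (max 0 (g \<omega> i - f i))\<^sup>2) \<le> Z \<omega>" "expectation Z \<le> 264 * ?B"
    by (rule isotonic_one_sided_risk[OF n s V ind sq mean var anti fV g]) (auto simp: mult.assoc)
  have "indep_vars (\<lambda>_. borel) \<epsilon> (?r ` {..<n})"
    by (rule indep_vars_subset[OF ind]) auto
  moreover have "inj_on ?r {..<n}" by (auto simp: inj_on_def)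
  ultimately have "indep_vars (\<lambda>_. borel) (\<lambda>i. \<epsilon> (?r i)) {..<n}"
    using indep_vars_reindex by blast
  from indep_vars_compose2[OF this, of "\<lambda>_ x. - x"]
  have ind': "indep_vars (\<lambda>_. borel) (\<lambda>i \<omega>. - \<epsilon> (?r i) \<omega>) {..<n}" by auto
  have g': "isotonic_minimizer n (\<lambda>i. - f (?r i) + - \<epsilon> (?r i) \<omega>) (\<lambda>i. - g \<omega> (?r i))" for \<omega>
    using isotonic_minimizer_reflect[OF g[of \<omega>]] by simp
  obtain Y where Y: "integrable M Y" "\<And>\<omega>. 0 \<le> Y \<omega>"
    "\<And>\<omega>. (\<Sum>i<n. (max 0 (- g \<omega> (?r i) - - f (?r i)))\<^sup>2) \<le> Y \<omega>" "expectation Y \<le> 264 * ?B"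
    by (rule isotonic_one_sided_risk[OF n s V ind' _ _ _ antimono_on_reflect[OF anti] _ g'])
       (use sq mean var n fV in \<open>auto simp: mult.assoc\<close>)
  have le: "(\<Sum>i<n. (g \<omega> i - f i)\<^sup>2) \<le> Z \<omega> + Y \<omega>" for \<omega>
  proof -
    have "(\<Sum>i<n. (g \<omega> i - f i)\<^sup>2)
        = (\<Sum>i<n. (max 0 (g \<omega> i - f i))\<^sup>2) + (\<Sum>i<n. (max 0 (f i - g \<omega> i))\<^sup>2)"
      unfolding sum.distrib[symmetric] by (intro sum.cong) (auto simp: max_def power2_commute)
    also have "(\<Sum>i<n. (max 0 (f i - g \<omega> i))\<^sup>2) = (\<Sum>i<n. (max 0 (f (?r i) - g \<omega> (?r i)))\<^sup>2)"
      by (rule sum.nat_diff_reindex[symmetric])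
    also have "\<dots> \<le> Y \<omega>" using Y(3)[of \<omega>] by simp
    finally show ?thesis using Z(3)[of \<omega>] by simp
  qed
  have "(\<integral>\<^sup>+\<omega>. ennreal (\<Sum>i<n. (g \<omega> i - f i)\<^sup>2) \<partial>M) \<le> (\<integral>\<^sup>+\<omega>. ennreal (Z \<omega> + Y \<omega>) \<partial>M)"
    using le by (intro nn_integral_mono ennreal_leI) auto
  also have "\<dots> = ennreal (expectation (\<lambda>\<omega>. Z \<omega> + Y \<omega>))"
    using Z Y by (intro nn_integral_eq_integral) auto
  also have "\<dots> \<le> ennreal (528 * ?B)"
    using Z Y by (intro ennreal_leI) simp
  finally show ?thesis by (simp add: mult.assoc)
qed

end

section \<open>Moments of the exponential family\<close>

lemma power_le_fact_mult_exp:
  fixes y :: real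
  assumes "y \<ge> 0"
  shows "y ^ k \<le> fact k * exp y"
proof -
  have "(\<Sum>i\<in>{k}. inverse (fact i) * y ^ i) \<le> (\<Sum>i. inverse (fact i) * y ^ i)"
    using assms by (intro sum_le_suminf summable_exp) auto
  then have "y ^ k / fact k \<le> exp y" by (simp add: exp_def divide_inverse mult.commute)
  then show ?thesis by (simp add: field_simps)
qed

lemma abs_exp_minus_1_le: "\<bar>exp u - 1\<bar> \<le> \<bar>u\<bar> * exp \<bar>u\<bar>" for u :: real
proof (cases "u \<ge> 0")
  case True
  have "1 - u \<le> exp (- u)" using exp_ge_add_one_self[of "- u"] by simp
  then have "(1 - u) * exp u \<le> exp (- u) * exp u" by (intro mult_right_mono) auto
  then show ?thesis using True by (simp add: exp_minus algebra_simps)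
next
  case False
  have "1 + u \<le> exp u" by (rule exp_ge_add_one_self)
  moreover have "- u \<le> - u * exp (- u)" using False by (intro mult_le_cancel_left1[THEN iffD2]) auto
  moreover have "\<bar>u\<bar> = - u" "\<bar>exp u - 1\<bar> = 1 - exp u" using False by auto
  ultimately show ?thesis by (smt (verit))
qed

text \<open>To be applied with the carrier measure as \<open>\<nu>\<close>; there
  \<open>integrable_exp\<close> is the normalisability of the family.\<close>

locale laplace_transform =
  fixes \<nu> :: "real measure" and \<Theta> :: "real set"
  assumes sets_\<nu> [measurable_cong]: "sets \<nu> = sets borel"
    and open_domain: "open \<Theta>"
    and integrable_exp: "\<And>\<theta>. \<theta> \<in> \<Theta> \<Longrightarrow> integrable \<nu> (\<lambda>x. exp (\<theta> * x))"
begin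

definition moment :: "nat \<Rightarrow> real \<Rightarrow> real" where
  "moment k \<theta> = (\<integral>x. x ^ k * exp (\<theta> * x) \<partial>\<nu>)"

text \<open>A power of \<open>|x|\<close> is absorbed by a further factor
  \<open>exp (\<delta> * |x|)\<close>, and \<open>exp (2 * \<delta> * |x|)\<close> is split into the
  two signs of \<open>x\<close>, leading to the parameters \<open>\<theta> + 2 * \<delta>\<close>
  and \<open>\<theta> - 2 * \<delta>\<close>. The extra \<open>\<delta> * |x|\<close> in the
  conclusion later dominates difference quotients.\<close>

lemma integrable_power_exp_neighbourhood:
  assumes "\<theta> \<in> \<Theta>"
  obtains \<delta> where "\<delta> > 0" "\<And>k. integrable \<nu> (\<lambda>x. \<bar>x\<bar> ^ k * exp (\<theta> * x + \<delta> * \<bar>x\<bar>))"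
proof -
  obtain e where e: "e > 0" "cball \<theta> e \<subseteq> \<Theta>"
    using open_domain assms open_contains_cball by blast
  \<comment> \<open>Half the radius, since one \<open>\<delta>\<close> is spent on the power and one
    on the exponential.\<close>
  define \<delta> where "\<delta> = e / 2"
  have \<delta>: "\<delta> > 0" using e by (simp add: \<delta>_def)
  have dom: "\<theta> + 2 * \<delta> \<in> \<Theta>" "\<theta> - 2 * \<delta> \<in> \<Theta>"
    using e by (auto simp: \<delta>_def dist_real_def intro!: subsetD[OF e(2)])
  show ?thesis
  proof (rule that[OF \<delta>])
    fix k
    let ?D = "\<lambda>x. fact k / \<delta> ^ k * (exp ((\<theta> + 2 * \<delta>) * x) + exp ((\<theta> - 2 * \<delta>) * x))"
    have le: "\<bar>x\<bar> ^ k * exp (\<theta> * x + \<delta> * \<bar>x\<bar>) \<le> ?D x" for x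
    proof -
      have "(\<delta> * \<bar>x\<bar>) ^ k \<le> fact k * exp (\<delta> * \<bar>x\<bar>)"
        using \<delta> by (intro power_le_fact_mult_exp) auto
      then have "\<bar>x\<bar> ^ k \<le> fact k / \<delta> ^ k * exp (\<delta> * \<bar>x\<bar>)"
        using \<delta> by (simp add: power_mult_distrib field_simps)
      then have "\<bar>x\<bar> ^ k * exp (\<theta> * x + \<delta> * \<bar>x\<bar>)
          \<le> fact k / \<delta> ^ k * exp (\<delta> * \<bar>x\<bar>) * exp (\<theta> * x + \<delta> * \<bar>x\<bar>)"
        by (intro mult_right_mono) auto
      also have "\<dots> = fact k / \<delta> ^ k * exp (\<theta> * x + 2 * \<delta> * \<bar>x\<bar>)"
        by (simp add: mult.assoc flip: exp_add)
      also have "\<dots> \<le> ?D x"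
      proof (rule mult_left_mono)
        show "exp (\<theta> * x + 2 * \<delta> * \<bar>x\<bar>) \<le> exp ((\<theta> + 2 * \<delta>) * x) + exp ((\<theta> - 2 * \<delta>) * x)"
        by (cases "x \<ge> 0") (auto simp: algebra_simps add_increasing add_increasing2)
      qed (use \<delta> in auto)
      finally show ?thesis .
    qed
    show "integrable \<nu> (\<lambda>x. \<bar>x\<bar> ^ k * exp (\<theta> * x + \<delta> * \<bar>x\<bar>))"
    proof (rule Bochner_Integration.integrable_bound)
      show "integrable \<nu> ?D" using integrable_exp[OF dom(1)] integrable_exp[OF dom(2)] by simp
      show "AE x in \<nu>. norm (\<bar>x\<bar> ^ k * exp (\<theta> * x + \<delta> * \<bar>x\<bar>)) \<le> norm (?D x)"
      proof (rule AE_I2)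
        fix x
        have "0 \<le> \<bar>x\<bar> ^ k * exp (\<theta> * x + \<delta> * \<bar>x\<bar>)" by simp
        then show "norm (\<bar>x\<bar> ^ k * exp (\<theta> * x + \<delta> * \<bar>x\<bar>)) \<le> norm (?D x)"
          unfolding real_norm_def using le[of x] by linarith
      qed
    qed measurable
  qed
qed

lemma integrable_power_exp:
  assumes "\<theta> \<in> \<Theta>"
  shows "integrable \<nu> (\<lambda>x. x ^ k * exp (\<theta> * x))"
proof -
  obtain \<delta> where \<delta>: "\<delta> > 0" "\<And>k. integrable \<nu> (\<lambda>x. \<bar>x\<bar> ^ k * exp (\<theta> * x + \<delta> * \<bar>x\<bar>))"
    using integrable_power_exp_neighbourhood[OF assms] by blast
  show ?thesis
    by (rule Bochner_Integration.integrable_bound[OF \<delta>(2)[of k]])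
       (use \<delta>(1) in \<open>auto intro!: AE_I2 mult_left_mono simp: abs_mult power_abs\<close>)
qed

text \<open>Dominated convergence for the difference quotients along an arbitrary null sequence. By
  \<open>abs_exp_minus_1_le\<close> they are dominated by
  \<open>|x|^(k + 1) * exp (\<theta> * x + \<delta> * |x|)\<close>.\<close>

lemma has_field_derivative_moment:
  assumes "\<theta> \<in> \<Theta>"
  shows "(moment k has_field_derivative moment (Suc k) \<theta>) (at \<theta>)"
proof -
  obtain \<delta> where \<delta>: "\<delta> > 0" "\<And>k. integrable \<nu> (\<lambda>x. \<bar>x\<bar> ^ k * exp (\<theta> * x + \<delta> * \<bar>x\<bar>))"
    using integrable_power_exp_neighbourhood[OF assms] by blast
  obtain e where e: "e > 0" "ball \<theta> e \<subseteq> \<Theta>"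
    using open_domain assms open_contains_ball by blast
  have "((\<lambda>h. (moment k (\<theta> + h) - moment k \<theta>) / h) \<longlongrightarrow> moment (Suc k) \<theta>) (at 0)"
    unfolding tendsto_at_iff_sequentially
  proof safe
    fix X :: "nat \<Rightarrow> real"
    assume X: "\<forall>i. X i \<in> UNIV - {0}" "X \<longlonglongrightarrow> 0"
    then have X0: "X i \<noteq> 0" for i by auto
    \<comment> \<open>The bound \<open>\<delta>\<close> serves the domination, and \<open>e\<close>
      keeps the shifted parameter in \<open>\<Theta>\<close>.\<close>
    have "\<forall>\<^sub>F i in sequentially. \<bar>X i\<bar> < min \<delta> e"
      using tendstoD[OF X(2), of "min \<delta> e"] \<delta>(1) e(1) by simp
    then obtain N where N: "\<And>i. i \<ge> N \<Longrightarrow> \<bar>X i\<bar> < min \<delta> e"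
      by (auto simp: eventually_sequentially)
    define Q where "Q i x = x ^ k * ((exp ((\<theta> + X (i + N)) * x) - exp (\<theta> * x)) / X (i + N))" for i x
    have "(\<lambda>i. \<integral>x. Q i x \<partial>\<nu>) \<longlonglongrightarrow> (\<integral>x. x ^ Suc k * exp (\<theta> * x) \<partial>\<nu>)"
    proof (rule integral_dominated_convergence)
      show "(\<lambda>x. x ^ Suc k * exp (\<theta> * x)) \<in> borel_measurable \<nu>" by measurable
      show "\<And>i. Q i \<in> borel_measurable \<nu>" unfolding Q_def by measurable
      show "integrable \<nu> (\<lambda>x. \<bar>x\<bar> ^ Suc k * exp (\<theta> * x + \<delta> * \<bar>x\<bar>))" by (rule \<delta>(2))
      show "AE x in \<nu>. (\<lambda>i. Q i x) \<longlonglongrightarrow> x ^ Suc k * exp (\<theta> * x)"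
      proof (rule AE_I2)
        fix x
        have "((\<lambda>t. exp (t * x)) has_field_derivative x * exp (\<theta> * x)) (at \<theta>)"
          by (auto intro!: derivative_eq_intros)
        then have "((\<lambda>h. (exp ((\<theta> + h) * x) - exp (\<theta> * x)) / h) \<longlongrightarrow> x * exp (\<theta> * x)) (at 0)"
          by (simp add: DERIV_def)
        moreover have "(\<lambda>i. X (i + N)) \<longlonglongrightarrow> 0" using X(2) by (rule LIMSEQ_ignore_initial_segment)
        ultimately have "(\<lambda>i. (exp ((\<theta> + X (i + N)) * x) - exp (\<theta> * x)) / X (i + N)) \<longlonglongrightarrow> x * exp (\<theta> * x)"
          unfolding tendsto_at_iff_sequentially using X0 by (force simp: o_def)
        from tendsto_mult_left[OF this, of "x ^ k"]
        show "(\<lambda>i. Q i x) \<longlonglongrightarrow> x ^ Suc k * exp (\<theta> * x)" by (simp add: Q_def mult_ac)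
      qed
      show "AE x in \<nu>. norm (Q i x) \<le> \<bar>x\<bar> ^ Suc k * exp (\<theta> * x + \<delta> * \<bar>x\<bar>)" for i
      proof (rule AE_I2)
        fix x
        let ?h = "X (i + N)"
        have h: "\<bar>?h\<bar> \<le> \<delta>" "?h \<noteq> 0" using N[of "i + N"] X0 by auto
        have "norm (Q i x) = \<bar>x\<bar> ^ k * (exp (\<theta> * x) * \<bar>exp (?h * x) - 1\<bar> / \<bar>?h\<bar>)"
        proof -
          have "exp ((\<theta> + ?h) * x) - exp (\<theta> * x) = exp (\<theta> * x) * (exp (?h * x) - 1)"
            by (simp add: distrib_right exp_add right_diff_distrib)
          then show ?thesis by (simp add: Q_def abs_mult power_abs)
        qed
        also have "\<dots> \<le> \<bar>x\<bar> ^ k * (exp (\<theta> * x) * (\<bar>?h * x\<bar> * exp \<bar>?h * x\<bar>) / \<bar>?h\<bar>)"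
          using abs_exp_minus_1_le[of "?h * x"] by (intro mult_left_mono divide_right_mono) auto
        also have "\<dots> = \<bar>x\<bar> ^ Suc k * (exp (\<theta> * x) * exp (\<bar>?h\<bar> * \<bar>x\<bar>))"
          using h(2) by (simp add: abs_mult)
        also have "\<dots> \<le> \<bar>x\<bar> ^ Suc k * (exp (\<theta> * x) * exp (\<delta> * \<bar>x\<bar>))"
          using h(1) by (intro mult_left_mono) (auto intro: mult_right_mono)
        finally show "norm (Q i x) \<le> \<bar>x\<bar> ^ Suc k * exp (\<theta> * x + \<delta> * \<bar>x\<bar>)"
          by (simp add: exp_add)
      qed
    qed
    moreover have "(\<integral>x. Q i x \<partial>\<nu>) = (moment k (\<theta> + X (i + N)) - moment k \<theta>) / X (i + N)" for i
    proof -
      have "\<theta> + X (i + N) \<in> \<Theta>"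
        using N[of "i + N"] by (intro subsetD[OF e(2)]) (auto simp: dist_real_def)
      from integrable_power_exp[OF this, of k] integrable_power_exp[OF assms, of k]
      have "moment k (\<theta> + X (i + N)) - moment k \<theta>
          = (\<integral>x. x ^ k * exp ((\<theta> + X (i + N)) * x) - x ^ k * exp (\<theta> * x) \<partial>\<nu>)"
        by (simp add: moment_def)
      then show ?thesis by (simp add: Q_def right_diff_distrib flip: integral_divide_zero)
    qed
    ultimately have "(\<lambda>i. (moment k (\<theta> + X (i + N)) - moment k \<theta>) / X (i + N)) \<longlonglongrightarrow> moment (Suc k) \<theta>"
      by (simp add: moment_def)
    then show "((\<lambda>h. (moment k (\<theta> + h) - moment k \<theta>) / h) \<circ> X) \<longlonglongrightarrow> moment (Suc k) \<theta>"
      unfolding o_def by (rule LIMSEQ_offset)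
  qed
  then show ?thesis by (simp add: DERIV_def)
qed

end

section \<open>Mean and variance as derivatives of the log-partition function\<close>

context regular_exp_family
begin

abbreviation "np \<equiv> natural_param \<Theta> b"
abbreviation "P \<equiv> exp_family_measure \<rho> c b"

text \<open>With the carrier absorbed into the base measure, all members of the family have strictly
  positive densities of purely exponential form.\<close>

definition carrier_measure :: "real measure" where
  "carrier_measure = density \<rho> (\<lambda>x. ennreal (c x))"

declare sets_base [measurable_cong]

lemma measurable_carrier [measurable]: "c \<in> borel_measurable \<rho>"
  using carrier_measurable by (simp add: measurable_cong_sets[OF sets_base refl])

lemma sets_carrier_measure [measurable_cong]: "sets carrier_measure = sets borel"
  by (simp add: carrier_measure_def sets_base)

lemma exp_family_measure_eq_density:
  "P \<theta> = density carrier_measure (\<lambda>x. ennreal (exp (\<theta> * x - b \<theta>)))"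
proof -
  have "density carrier_measure (\<lambda>x. ennreal (exp (\<theta> * x - b \<theta>)))
      = density \<rho> (\<lambda>x. ennreal (c x) * ennreal (exp (\<theta> * x - b \<theta>)))"
    unfolding carrier_measure_def by (rule density_density_eq) measurable
  also have "(\<lambda>x. ennreal (c x) * ennreal (exp (\<theta> * x - b \<theta>))) = (\<lambda>x. ennreal (exp (\<theta> * x - b \<theta>) * c x))"
    by (simp add: fun_eq_iff mult.commute flip: ennreal_mult'')
  finally show ?thesis by (simp add: exp_family_measure_def)
qed

lemma sets_exp_family_measure [measurable_cong, simp]: "sets (P \<theta>) = sets borel"
  by (simp add: exp_family_measure_def sets_base)

lemma space_exp_family_measure [simp]: "space (P \<theta>) = UNIV"
  using sets_eq_imp_space_eq[OF sets_exp_family_measure] by simp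

lemma integrable_exp_carrier_measure:
  assumes "\<theta> \<in> \<Theta>"
  shows "integrable carrier_measure (\<lambda>x. exp (\<theta> * x))"
    and "(\<integral>x. exp (\<theta> * x) \<partial>carrier_measure) = exp (b \<theta>)"
proof -
  interpret prob_space "P \<theta>" by (rule prob_space_family[OF assms])
  have "has_bochner_integral (P \<theta>) (\<lambda>x. 1::real) 1"
    using prob_space by (simp add: has_bochner_integral_iff)
  then have "has_bochner_integral (density carrier_measure (\<lambda>x. ennreal (exp (\<theta> * x - b \<theta>)))) (\<lambda>x. 1::real) 1"
    by (simp only: exp_family_measure_eq_density)
  then have "has_bochner_integral carrier_measure (\<lambda>x. exp (\<theta> * x - b \<theta>)) 1"
    by (simp add: has_bochner_integral_iff integrable_density integral_density del: lebesgue_integral_const)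
  from has_bochner_integral_mult_right[OF this, of "exp (b \<theta>)"]
  have "has_bochner_integral carrier_measure (\<lambda>x. exp (\<theta> * x)) (exp (b \<theta>))"
    by (simp flip: exp_add)
  then show "integrable carrier_measure (\<lambda>x. exp (\<theta> * x))"
    "(\<integral>x. exp (\<theta> * x) \<partial>carrier_measure) = exp (b \<theta>)"
    by (auto simp: has_bochner_integral_iff)
qed

sublocale laplace_transform carrier_measure \<Theta>
  using sets_carrier_measure open_params integrable_exp_carrier_measure
  by unfold_locales

lemma moment_0: "\<theta> \<in> \<Theta> \<Longrightarrow> moment 0 \<theta> = exp (b \<theta>)"
  by (simp add: moment_def integrable_exp_carrier_measure)

lemma exp_family_moments:
  assumes "\<theta> \<in> \<Theta>"
  shows "integrable (P \<theta>) (\<lambda>x. x ^ k)" "(\<integral>x. x ^ k \<partial>P \<theta>) = moment k \<theta> / moment 0 \<theta>"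
proof -
  have eq: "exp (\<theta> * x - b \<theta>) * x ^ k = x ^ k * exp (\<theta> * x) / exp (b \<theta>)" for x
    by (simp add: exp_diff)
  show "integrable (P \<theta>) (\<lambda>x. x ^ k)"
    unfolding exp_family_measure_eq_density using integrable_power_exp[OF assms, of k]
    by (subst integrable_density) (auto simp: eq)
  show "(\<integral>x. x ^ k \<partial>P \<theta>) = moment k \<theta> / moment 0 \<theta>"
    unfolding exp_family_measure_eq_density
    by (subst integral_density) (auto simp: eq moment_0 assms, simp add: moment_def)
qed

lemma has_field_derivative_log_partition:
  "\<theta> \<in> \<Theta> \<Longrightarrow> (b has_field_derivative deriv b \<theta>) (at \<theta>)"
  "\<theta> \<in> \<Theta> \<Longrightarrow> (deriv b has_field_derivative deriv (deriv b) \<theta>) (at \<theta>)"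
  using differentiable differentiable_twice by (auto simp: DERIV_deriv_iff_field_differentiable)

text \<open>On the open set \<open>\<Theta>\<close> the functions \<open>exp (b \<theta>)\<close>
  and \<open>moment 0 \<theta>\<close> agree; comparing their derivatives gives the mean.\<close>

lemma deriv_log_partition:
  assumes "\<theta> \<in> \<Theta>"
  shows "deriv b \<theta> = moment 1 \<theta> / moment 0 \<theta>"
proof -
  have "((\<lambda>t. exp (b t)) has_field_derivative exp (b \<theta>) * deriv b \<theta>) (at \<theta>)"
    using has_field_derivative_log_partition(1)[OF assms] by (auto intro!: derivative_eq_intros)
  then have "(moment 0 has_field_derivative exp (b \<theta>) * deriv b \<theta>) (at \<theta>)"
    by (rule has_field_derivative_transform_within_open[OF _ open_params assms]) (simp add: moment_0)
  with has_field_derivative_moment[OF assms, of 0] have "moment 1 \<theta> = exp (b \<theta>) * deriv b \<theta>"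
    by (auto dest: DERIV_unique)
  then show ?thesis using assms by (simp add: moment_0)
qed

lemma deriv2_log_partition:
  assumes "\<theta> \<in> \<Theta>"
  shows "deriv (deriv b) \<theta> = moment 2 \<theta> / moment 0 \<theta> - (deriv b \<theta>)\<^sup>2"
proof -
  have pos: "moment 0 \<theta> \<noteq> 0" using assms by (simp add: moment_0)
  have "((\<lambda>t. moment 1 t / moment 0 t) has_field_derivative
      (moment 2 \<theta> * moment 0 \<theta> - moment 1 \<theta> * moment 1 \<theta>) / (moment 0 \<theta> * moment 0 \<theta>)) (at \<theta>)"
    using has_field_derivative_moment[OF assms, of 0] has_field_derivative_moment[OF assms, of 1] pos
    by (intro DERIV_divide) (auto simp: numeral_2_eq_2)
  then have "(deriv b has_field_derivative
      (moment 2 \<theta> * moment 0 \<theta> - moment 1 \<theta> * moment 1 \<theta>) / (moment 0 \<theta> * moment 0 \<theta>)) (at \<theta>)"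
    by (rule has_field_derivative_transform_within_open[OF _ open_params assms]) (simp add: deriv_log_partition)
  then show ?thesis
    using pos by (simp add: DERIV_imp_deriv deriv_log_partition[OF assms] power2_eq_square diff_divide_distrib)
qed

lemma exp_family_mean:
  assumes "\<theta> \<in> \<Theta>"
  shows "integrable (P \<theta>) (\<lambda>x. x)" "(\<integral>x. x \<partial>P \<theta>) = deriv b \<theta>"
  using exp_family_moments[OF assms, of 1] by (auto simp: deriv_log_partition[OF assms])

lemma exp_family_variance:
  assumes "\<theta> \<in> \<Theta>"
  shows "integrable (P \<theta>) (\<lambda>x. (x - deriv b \<theta>)\<^sup>2)"
    "(\<integral>x. (x - deriv b \<theta>)\<^sup>2 \<partial>P \<theta>) = deriv (deriv b) \<theta>"
proof -
  interpret prob_space "P \<theta>" by (rule prob_space_family[OF assms])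
  have eq: "(x - deriv b \<theta>)\<^sup>2 = x\<^sup>2 - 2 * deriv b \<theta> * x + (deriv b \<theta>)\<^sup>2" for x
    by (simp add: power2_eq_square algebra_simps)
  note int = exp_family_mean[OF assms] exp_family_moments[OF assms, of 2]
  show "integrable (P \<theta>) (\<lambda>x. (x - deriv b \<theta>)\<^sup>2)" unfolding eq using int by auto
  have "(\<integral>x. (x - deriv b \<theta>)\<^sup>2 \<partial>P \<theta>) = moment 2 \<theta> / moment 0 \<theta> - 2 * deriv b \<theta> * deriv b \<theta> + (deriv b \<theta>)\<^sup>2"
    unfolding eq using int prob_space by simp
  then show "(\<integral>x. (x - deriv b \<theta>)\<^sup>2 \<partial>P \<theta>) = deriv (deriv b) \<theta>"
    by (simp add: deriv2_log_partition[OF assms] power2_eq_square)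
qed

text \<open>Continuity of \<open>b''\<close> is not an axiom but follows from the moment formula,
  since all moments are differentiable. It ensures that the maximum in \<open>max_variance\<close>
  is attained.\<close>

lemma continuous_on_deriv2_log_partition: "continuous_on \<Theta> (deriv (deriv b))"
proof -
  have "continuous_on \<Theta> (moment k)" for k
    using has_field_derivative_moment by (meson DERIV_isCont continuous_at_imp_continuous_on)
  moreover have "continuous_on \<Theta> (deriv b)"
    using has_field_derivative_log_partition(2) by (meson DERIV_isCont continuous_at_imp_continuous_on)
  moreover have "\<forall>\<theta>\<in>\<Theta>. moment 0 \<theta> \<noteq> 0" by (simp add: moment_0)
  ultimately have "continuous_on \<Theta> (\<lambda>\<theta>. moment 2 \<theta> / moment 0 \<theta> - (deriv b \<theta>)\<^sup>2)"
    by (intro continuous_intros)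
  then show ?thesis by (rule continuous_on_eq) (simp add: deriv2_log_partition)
qed

lemma atLeastAtMost_subset_params: "s \<in> \<Theta> \<Longrightarrow> t \<in> \<Theta> \<Longrightarrow> {s..t} \<subseteq> \<Theta>"
  by (rule subsetI, rule mem_is_interval_1_I[OF interval_params, of s t]) auto

lemma deriv_log_partition_strict_mono:
  assumes "s \<in> \<Theta>" "t \<in> \<Theta>" "s < t"
  shows "deriv b s < deriv b t"
proof (rule DERIV_pos_imp_increasing[OF assms(3)])
  fix x assume "s \<le> x" "x \<le> t"
  then have "x \<in> \<Theta>" using atLeastAtMost_subset_params[OF assms(1,2)] by auto
  then show "\<exists>y. (deriv b has_real_derivative y) (at x) \<and> 0 < y"
    using has_field_derivative_log_partition(2) deriv2_pos by blast
qed

lemma deriv_log_partition_less_iff: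
  "s \<in> \<Theta> \<Longrightarrow> t \<in> \<Theta> \<Longrightarrow> deriv b s < deriv b t \<longleftrightarrow> s < t"
  using deriv_log_partition_strict_mono[of s t] deriv_log_partition_strict_mono[of t s]
  by (cases s t rule: linorder_cases) simp_all

lemma inj_on_deriv_log_partition: "inj_on (deriv b) \<Theta>"
proof (rule linorder_inj_onI')
  fix s t assume "s \<in> \<Theta>" "t \<in> \<Theta>" "s < t"
  then show "deriv b s \<noteq> deriv b t" using deriv_log_partition_strict_mono[of s t] by simp
qed

lemma natural_param_deriv: "\<theta> \<in> \<Theta> \<Longrightarrow> np (deriv b \<theta>) = \<theta>"
  unfolding natural_param_def by (rule inv_into_f_f[OF inj_on_deriv_log_partition])

section \<open>Parametrisation by the mean on a compact range\<close>

context
  fixes Vmin Vmax :: real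
  assumes V: "Vmin \<in> deriv b ` \<Theta>" "Vmax \<in> deriv b ` \<Theta>" "Vmin < Vmax"
begin

lemma mean_in_image:
  assumes "\<mu> \<in> {Vmin..Vmax}"
  shows "\<mu> \<in> deriv b ` \<Theta>"
proof -
  have "continuous_on \<Theta> (deriv b)"
    using has_field_derivative_log_partition(2) by (meson DERIV_isCont continuous_at_imp_continuous_on)
  moreover have "connected \<Theta>" using interval_params by (simp add: is_interval_connected_1)
  ultimately have "is_interval (deriv b ` \<Theta>)"
    by (simp add: is_interval_connected_1 connected_continuous_image)
  then show ?thesis
    by (rule mem_is_interval_1_I[of _ Vmin Vmax]) (use V assms in auto)
qed

lemma natural_param:
  assumes "\<mu> \<in> {Vmin..Vmax}"
  shows "np \<mu> \<in> \<Theta>" "deriv b (np \<mu>) = \<mu>"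
  using mean_in_image[OF assms] by (auto simp: natural_param_deriv)

lemma max_variance:
  shows "max_variance \<Theta> b Vmin Vmax > 0"
    "\<mu> \<in> {Vmin..Vmax} \<Longrightarrow> deriv (deriv b) (np \<mu>) \<le> max_variance \<Theta> b Vmin Vmax"
proof -
  let ?I = "{np Vmin..np Vmax}"
  have mem: "np Vmin \<in> \<Theta>" "np Vmax \<in> \<Theta>" "deriv b (np Vmin) = Vmin" "deriv b (np Vmax) = Vmax"
    using natural_param[of Vmin] natural_param[of Vmax] V(3) by auto
  have sub: "?I \<subseteq> \<Theta>" using atLeastAtMost_subset_params mem by blast
  have "np Vmin < np Vmax" using deriv_log_partition_less_iff[OF mem(1,2)] mem V(3) by simp
  then obtain t where t: "t \<in> ?I" "\<And>s. s \<in> ?I \<Longrightarrow> deriv (deriv b) s \<le> deriv (deriv b) t"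
    using continuous_attains_sup[of ?I "deriv (deriv b)"]
      continuous_on_subset[OF continuous_on_deriv2_log_partition sub] by auto
  have eq: "max_variance \<Theta> b Vmin Vmax = deriv (deriv b) t"
    unfolding max_variance_def using t by (intro Greatest_equality) auto
  show "max_variance \<Theta> b Vmin Vmax > 0" using t sub deriv2_pos by (auto simp: eq)
  assume \<mu>: "\<mu> \<in> {Vmin..Vmax}"
  have "np \<mu> \<in> ?I"
    using deriv_log_partition_less_iff[OF natural_param(1)[OF \<mu>] mem(1)]
      deriv_log_partition_less_iff[OF mem(2) natural_param(1)[OF \<mu>]] natural_param(2)[OF \<mu>] mem \<mu>
    by (auto simp: not_less[symmetric])
  then show "deriv (deriv b) (np \<mu>) \<le> max_variance \<Theta> b Vmin Vmax" using t by (simp add: eq)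
qed

end

end

section \<open>Risk bounds\<close>

text \<open>Cutting \<open>G\<close> off at 0 only raises its integral and respects the bound, as
  \<open>ennreal\<close> truncates negative values. The integrand in \<open>two_point_risk\<close>
  can be negative at some points.\<close>

lemma nn_integral_ge_integral:
  fixes G F :: "'a \<Rightarrow> real"
  assumes "integrable M G" "\<And>x. x \<in> space M \<Longrightarrow> G x \<le> F x"
  shows "ennreal (integral\<^sup>L M G) \<le> (\<integral>\<^sup>+x. ennreal (F x) \<partial>M)"
proof -
  have int: "integrable M (\<lambda>x. max 0 (G x))" using assms(1) by simp
  have "ennreal (integral\<^sup>L M G) \<le> ennreal (integral\<^sup>L M (\<lambda>x. max 0 (G x)))"
    using assms(1) int by (intro ennreal_leI integral_mono) auto
  also have "\<dots> = (\<integral>\<^sup>+x. ennreal (max 0 (G x)) \<partial>M)"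
    using int by (intro nn_integral_eq_integral[symmetric]) auto
  also have "\<dots> \<le> (\<integral>\<^sup>+x. ennreal (F x) \<partial>M)"
    using assms(2) by (intro nn_integral_mono) (auto simp: max_def intro: ennreal_leI)
  finally show ?thesis .
qed

text \<open>The left-hand side is minimised over \<open>t\<close> with value
  \<open>(m1 - m0)\<^sup>2 p0 p1 / (p0 + p1)\<close>, which is bounded below by completing the square.\<close>

lemma weighted_squares_ge_sqrt:
  fixes p0 p1 t m0 m1 :: real
  assumes "p0 \<ge> 0" "p1 \<ge> 0"
  shows "(m1 - m0)\<^sup>2 * (sqrt (p0 * p1) - (p0 + p1) / 4) \<le> p0 * (t - m0)\<^sup>2 + p1 * (t - m1)\<^sup>2"
proof (cases "p0 + p1 = 0")
  case True
  then have "p0 = 0" "p1 = 0" using assms by auto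
  then show ?thesis by simp
next
  case False
  then have s: "p0 + p1 > 0" using assms by auto
  have "(p0 + p1) * ((m1 - m0)\<^sup>2 * (sqrt (p0 * p1) - (p0 + p1) / 4))
      = (m1 - m0)\<^sup>2 * ((sqrt (p0 * p1))\<^sup>2 - (sqrt (p0 * p1) - (p0 + p1) / 2)\<^sup>2)"
    by (simp add: power2_eq_square) (simp add: field_simps)
  also have "\<dots> \<le> (m1 - m0)\<^sup>2 * (sqrt (p0 * p1))\<^sup>2"
    by (intro mult_left_mono) auto
  also have "\<dots> = (m1 - m0)\<^sup>2 * (p0 * p1)"
    using assms by simp
  also have "\<dots> \<le> (m1 - m0)\<^sup>2 * (p0 * p1) + (p0 * (t - m0) + p1 * (t - m1))\<^sup>2" by simp
  also have "\<dots> = (p0 + p1) * (p0 * (t - m0)\<^sup>2 + p1 * (t - m1)\<^sup>2)"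
    by (simp add: power2_eq_square algebra_simps)
  finally show ?thesis using s by simp
qed

section \<open>Two hypotheses about a single coordinate\<close>

context regular_exp_family
begin

text \<open>On each half of the interval the slope of \<open>b\<close> is compared with the
  derivative at the outer endpoint; this costs at most 1/4 in the exponent. The value 3/4 matters
  because it exceeds the 1/2 that is subtracted in \<open>two_point_risk\<close>.\<close>

lemma affinity_ge:
  assumes s: "s \<in> \<Theta>" and t: "t \<in> \<Theta>" "s < t" and le: "(t - s) * (deriv b t - deriv b s) \<le> 1"
  shows "exp (b ((s + t) / 2) - (b s + b t) / 2) \<ge> 3 / 4"
proof -
  define m where "m = (s + t) / 2"
  have m: "s < m" "m < t" using t by (auto simp: m_def)
  have sub: "{s..t} \<subseteq> \<Theta>" by (rule atLeastAtMost_subset_params[OF s t(1)])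
  have mono: "deriv b x \<le> deriv b y" if "x \<in> {s..t}" "y \<in> {s..t}" "x \<le> y" for x y
    using deriv_log_partition_strict_mono[of x y] subsetD[OF sub that(1)] subsetD[OF sub that(2)] that(3)
    by (cases "x = y") simp_all
  have D: "(b has_real_derivative deriv b x) (at x)" if "x \<in> {s..t}" for x
    using has_field_derivative_log_partition(1) sub that by blast
  have "\<exists>x>s. x < m \<and> b m - b s = (m - s) * deriv b x"
    by (rule MVT2[OF m(1) D]) (use m in auto)
  then obtain x where x: "s < x" "x < m" "b m - b s = (m - s) * deriv b x" by blast
  have "\<exists>y>m. y < t \<and> b t - b m = (t - m) * deriv b y"
    by (rule MVT2[OF m(2) D]) (use m in auto)
  then obtain y where y: "m < y" "y < t" "b t - b m = (t - m) * deriv b y" by blast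
  have ms: "m - s = (t - s) / 2" "t - m = (t - s) / 2" by (auto simp: m_def field_simps)
  have "(m - s) * deriv b s \<le> (m - s) * deriv b x" using x m by (intro mult_left_mono mono) auto
  then have "(t - s) / 2 * deriv b s \<le> b m - b s" unfolding x(3)[symmetric] unfolding ms .
  moreover have "(t - m) * deriv b y \<le> (t - m) * deriv b t" using y m by (intro mult_left_mono mono) auto
  then have "b t - b m \<le> (t - s) / 2 * deriv b t" unfolding y(3)[symmetric] unfolding ms .
  ultimately have "b m - (b s + b t) / 2 \<ge> - (((t - s) * (deriv b t - deriv b s)) / 4)"
    by (simp add: field_simps)
  then have "- (1 / 4) \<le> b m - (b s + b t) / 2" using le by linarith
  then have "exp (- (1 / 4)) \<le> exp (b m - (b s + b t) / 2)" by simp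
  moreover have "1 + - (1 / 4) \<le> exp (- (1 / 4) :: real)" by (rule exp_ge_add_one_self)
  ultimately have "3 / 4 \<le> exp (b m - (b s + b t) / 2)" by linarith
  then show ?thesis by (simp only: m_def)
qed

lemma has_bochner_integral_density_1:
  assumes "\<theta> \<in> \<Theta>"
  shows "has_bochner_integral \<rho> (\<lambda>x. exp (\<theta> * x - b \<theta>) * c x) 1"
proof (rule has_bochner_integral_nn_integral)
  interpret prob_space "P \<theta>" by (rule prob_space_family[OF assms])
  have "emeasure (P \<theta>) (space (P \<theta>)) = 1" by (rule emeasure_space_1)
  then show "(\<integral>\<^sup>+x. ennreal (exp (\<theta> * x - b \<theta>) * c x) \<partial>\<rho>) = ennreal 1"
    unfolding exp_family_measure_def by (subst (asm) emeasure_density) auto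
qed (auto simp: carrier_nonneg)

lemma two_point_risk:
  fixes t :: "real \<Rightarrow> real"
  assumes [measurable]: "t \<in> borel_measurable borel"
    and r: "r \<in> \<Theta>" and s: "s \<in> \<Theta>" and rs: "r < s"
    and le: "(s - r) * (deriv b s - deriv b r) \<le> 1"
  shows "ennreal ((deriv b s - deriv b r)\<^sup>2 / 4) \<le>
    (\<integral>\<^sup>+x. ennreal ((t x - deriv b r)\<^sup>2) \<partial>P r) + (\<integral>\<^sup>+x. ennreal ((t x - deriv b s)\<^sup>2) \<partial>P s)"
proof -
  define p where "p \<theta> x = exp (\<theta> * x - b \<theta>) * c x" for \<theta> x
  have [measurable]: "p \<theta> \<in> borel_measurable \<rho>" for \<theta> unfolding p_def by measurable
  have p0: "0 \<le> p \<theta> x" for \<theta> x by (simp add: p_def carrier_nonneg)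
  have P: "P \<theta> = density \<rho> (\<lambda>x. ennreal (p \<theta> x))" for \<theta> by (simp add: exp_family_measure_def p_def)
  define m where "m = (r + s) / 2"
  define B where "B = exp (b m - (b r + b s) / 2)"
  have m: "m \<in> \<Theta>" using atLeastAtMost_subset_params[OF r s] rs by (auto simp: m_def)
  have B: "B \<ge> 3 / 4" unfolding B_def m_def by (rule affinity_ge[OF r s rs le])
  \<comment> \<open>The geometric mean of two members of the family is \<open>B\<close> times the
    member at the midpoint of the parameters. Its integral is therefore \<open>B\<close>, while the
    subtracted quarter of both densities integrates to 1/2.\<close>
  have sqrt_eq: "sqrt (p r x * p s x) = B * p m x" for x
  proof -
    have "p r x * p s x = (B * p m x)\<^sup>2"
      by (simp add: p_def B_def power2_eq_square flip: exp_add) (simp add: m_def field_simps flip: exp_add)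
    then show ?thesis using p0 by (simp add: B_def)
  qed
  let ?d = "(deriv b s - deriv b r)\<^sup>2"
  let ?G = "\<lambda>x. ?d * (sqrt (p r x * p s x) - (p r x + p s x) / 4)"
  have int: "integrable \<rho> (p \<theta>)" "integral\<^sup>L \<rho> (p \<theta>) = 1" if "\<theta> \<in> \<Theta>" for \<theta>
    using has_bochner_integral_density_1[OF that] by (auto simp: has_bochner_integral_iff p_def[abs_def])
  have G: "integrable \<rho> ?G" "integral\<^sup>L \<rho> ?G = ?d * (B - 1 / 2)"
    unfolding sqrt_eq using int[OF r] int[OF s] int[OF m] by auto
  have "?d / 4 \<le> ?d * (B - 1 / 2)" using mult_left_mono[of "1 / 4" "B - 1 / 2" ?d] B by simp
  then have "ennreal (?d / 4) \<le> ennreal (integral\<^sup>L \<rho> ?G)" unfolding G(2) by (rule ennreal_leI)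
  also have "\<dots> \<le> (\<integral>\<^sup>+x. ennreal (p r x * (t x - deriv b r)\<^sup>2 + p s x * (t x - deriv b s)\<^sup>2) \<partial>\<rho>)"
    using p0 by (intro nn_integral_ge_integral[OF G(1)] weighted_squares_ge_sqrt)
  also have "\<dots> = (\<integral>\<^sup>+x. ennreal (p r x) * ennreal ((t x - deriv b r)\<^sup>2)
      + ennreal (p s x) * ennreal ((t x - deriv b s)\<^sup>2) \<partial>\<rho>)"
    using p0 by (simp add: ennreal_mult)
  also have "\<dots> = (\<integral>\<^sup>+x. ennreal (p r x) * ennreal ((t x - deriv b r)\<^sup>2) \<partial>\<rho>)
      + (\<integral>\<^sup>+x. ennreal (p s x) * ennreal ((t x - deriv b s)\<^sup>2) \<partial>\<rho>)"
    by (intro nn_integral_add) measurable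
  also have "\<dots> = (\<integral>\<^sup>+x. ennreal ((t x - deriv b r)\<^sup>2) \<partial>P r) + (\<integral>\<^sup>+x. ennreal ((t x - deriv b s)\<^sup>2) \<partial>P s)"
    unfolding P by (simp add: nn_integral_density)
  finally show ?thesis .
qed

section \<open>Upper bound for the least squares estimator\<close>

context
  fixes Vmin Vmax :: real
  assumes V: "Vmin \<in> deriv b ` \<Theta>" "Vmax \<in> deriv b ` \<Theta>" "Vmin < Vmax"
begin

text \<open>Read in sorted order, the data are the signal \<open>\<mu> (\<pi> i)\<close> plus the
  independent noise \<open>\<epsilon> i\<close>, and the Euclidean loss is invariant under
  \<open>\<pi>\<close>; so \<open>isotonic_risk\<close> applies.\<close>

lemma isotonic_lse_risk:
  assumes n: "n \<ge> 2" and \<sigma>: "\<sigma> > 0" "\<sigma>\<^sup>2 = max_variance \<Theta> b Vmin Vmax"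
    and \<mu>: "\<mu> \<in> mean_box n Vmin Vmax" and \<pi>: "sorting_perm n \<mu> \<pi>"
  shows "risk \<rho> c \<Theta> b n (isotonic_lse n \<pi>) \<mu>
    \<le> ennreal (528 * real n * \<sigma>\<^sup>2 * min 1 (((Vmax - Vmin) / (real n * \<sigma>)) powr (2 / 3) + ln (real n) / real n))"
proof -
  define N where "N i = P (np (\<mu> i))" for i
  define M where "M = PiM {..<n} N"
  have \<mu>i: "\<mu> i \<in> {Vmin..Vmax}" if "i < n" for i
    using PiE_mem[OF \<mu>[unfolded mean_box_def], of i] that by simp
  have N: "prob_space (N i)" if "i < n" for i
    unfolding N_def using natural_param(1)[OF V \<mu>i[OF that]] by (rule prob_space_family)
  interpret prob_space M unfolding M_def by (rule prob_space_PiM) (use N in auto)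
  have law: "data_law \<rho> c \<Theta> b n \<mu> = M" by (simp add: data_law_def M_def N_def[abs_def])
  have perm: "\<pi> permutes {..<n}" and anti: "antimono_on {..<n} (\<lambda>i. \<mu> (\<pi> i))"
    using \<pi> by (auto simp: sorting_perm_def)
  have \<pi>n: "\<pi> i < n" if "i < n" for i using permutes_in_image[OF perm, of i] that by simp
  have inj: "inj_on \<pi> {..<n}" by (rule permutes_inj_on[OF perm])
  define \<epsilon> where "\<epsilon> i x = x (\<pi> i) - \<mu> (\<pi> i)" for i and x :: "nat \<Rightarrow> real"
  have "indep_vars N (\<lambda>i x. x i) {..<n}"
    unfolding M_def by (rule indep_vars_PiM_components) (use N n in \<open>auto simp: lessThan_empty_iff\<close>)
  then have "indep_vars N (\<lambda>i x. x i) (\<pi> ` {..<n})" by (simp add: permutes_image[OF perm])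
  from indep_vars_reindex[OF inj this]
  have "indep_vars (\<lambda>j. N (\<pi> j)) (\<lambda>j x. x (\<pi> j)) {..<n}" .
  from indep_vars_compose2[OF this, of "\<lambda>j t. t - \<mu> (\<pi> j)" "\<lambda>_. borel"]
  have ind: "indep_vars (\<lambda>_. borel) \<epsilon> {..<n}"
    unfolding \<epsilon>_def[abs_def] by (simp add: N_def)
  have distr: "distr M (N i) (\<lambda>x. x i) = N i" if "i < n" for i
    unfolding M_def by (rule distr_PiM_component) (use N that in auto)
  have comp: "(\<lambda>x. x i) \<in> measurable M (N i)" if "i < n" for i
    unfolding M_def using that by (intro measurable_component_singleton) auto
  have expect: "expectation (\<lambda>x. h (x i)) = integral\<^sup>L (N i) h"
    and int: "integrable M (\<lambda>x. h (x i)) \<longleftrightarrow> integrable (N i) h"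
    if "i < n" "h \<in> borel_measurable borel" for i and h :: "real \<Rightarrow> real"
  proof -
    have h: "h \<in> borel_measurable (N i)" using that(2) by (simp add: N_def)
    show "expectation (\<lambda>x. h (x i)) = integral\<^sup>L (N i) h"
      using integral_distr[OF comp[OF that(1)] h] distr[OF that(1)] by simp
    show "integrable M (\<lambda>x. h (x i)) \<longleftrightarrow> integrable (N i) h"
      using integrable_distr_eq[OF comp[OF that(1)] h] distr[OF that(1)] by simp
  qed
  have sq: "integrable M (\<lambda>x. (\<epsilon> j x)\<^sup>2)" and mean: "expectation (\<epsilon> j) = 0"
    and var: "expectation (\<lambda>x. (\<epsilon> j x)\<^sup>2) \<le> \<sigma>\<^sup>2" if j: "j < n" for j
  proof -
    note i = \<pi>n[OF j]
    note np = natural_param[OF V \<mu>i[OF i]]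
    interpret N: prob_space "N (\<pi> j)" by (rule N[OF i])
    show "integrable M (\<lambda>x. (\<epsilon> j x)\<^sup>2)"
      unfolding \<epsilon>_def using exp_family_variance(1)[OF np(1)] np(2)
      by (subst int[OF i]) (auto simp: N_def)
    have "expectation (\<lambda>x. (\<epsilon> j x)\<^sup>2) = deriv (deriv b) (np (\<mu> (\<pi> j)))"
      unfolding \<epsilon>_def using exp_family_variance(2)[OF np(1)] np(2)
      by (subst expect[OF i]) (auto simp: N_def)
    also have "\<dots> \<le> \<sigma>\<^sup>2" unfolding \<sigma>(2) by (rule max_variance(2)[OF V \<mu>i[OF i]])
    finally show "expectation (\<lambda>x. (\<epsilon> j x)\<^sup>2) \<le> \<sigma>\<^sup>2" .
    have "integrable (N (\<pi> j)) (\<lambda>x. x)" "(\<integral>x. x \<partial>N (\<pi> j)) = \<mu> (\<pi> j)"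
      unfolding N_def using exp_family_mean[OF np(1)] np(2) by auto
    then have "(\<integral>x. x - \<mu> (\<pi> j) \<partial>N (\<pi> j)) = 0" using N.prob_space by simp
    then show "expectation (\<epsilon> j) = 0"
      unfolding \<epsilon>_def[abs_def] by (subst expect[OF i]) auto
  qed
  have fV: "\<mu> (\<pi> 0) - \<mu> (\<pi> (n - 1)) \<le> Vmax - Vmin"
    using \<mu>i[OF \<pi>n, of 0] \<mu>i[OF \<pi>n, of "n - 1"] n by auto
  have "(L2_set (\<lambda>i. isotonic_lse n \<pi> x i - \<mu> i) {..<n})\<^sup>2
      = (\<Sum>i<n. (isotonic_lse n \<pi> x (\<pi> i) - \<mu> (\<pi> i))\<^sup>2)" for x
    using sum.permute[OF perm, of "\<lambda>i. (isotonic_lse n \<pi> x i - \<mu> i)\<^sup>2"]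
    by (simp add: L2_set_def sum_nonneg o_def)
  then have "risk \<rho> c \<Theta> b n (isotonic_lse n \<pi>) \<mu>
      = (\<integral>\<^sup>+x. ennreal (\<Sum>i<n. (isotonic_lse n \<pi> x (\<pi> i) - \<mu> (\<pi> i))\<^sup>2) \<partial>M)"
    by (simp add: risk_def law)
  also have "\<dots> \<le> ennreal (528 * real n * \<sigma>\<^sup>2 *
      min 1 (((Vmax - Vmin) / (real n * \<sigma>)) powr (2 / 3) + ln (real n) / real n))"
    using V(3) isotonic_lse_isotonic_minimizer[OF perm]
    by (intro isotonic_risk[OF n \<sigma>(1) _ ind sq mean var anti fV]) (auto simp: \<epsilon>_def)
  finally show ?thesis .
qed

end
end

text \<open>Integrating out all coordinates but \<open>i\<close> first reduces the pair of product laws to the pair of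
  \<open>i\<close>-th marginals.\<close>

lemma nn_integral_PiM_pair_ge:
  fixes N :: "'i \<Rightarrow> 'a measure"
  assumes I: "finite I" "i \<in> I" and N: "\<And>j. prob_space (N j)"
    and Q: "prob_space Q" "sets Q = sets (N i)"
    and f [measurable]: "f \<in> borel_measurable (PiM I N)" and g [measurable]: "g \<in> borel_measurable (PiM I N)"
    and le: "\<And>x. x \<in> space (PiM (I - {i}) N) \<Longrightarrow>
      K \<le> (\<integral>\<^sup>+y. f (x(i := y)) \<partial>N i) + (\<integral>\<^sup>+y. g (x(i := y)) \<partial>Q)"
  shows "K \<le> integral\<^sup>N (PiM I N) f + integral\<^sup>N (PiM I (N(i := Q))) g"
proof -
  let ?J = "I - {i}" and ?N' = "N(i := Q)"
  have I_eq: "insert i ?J = I" using I by auto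
  interpret N: product_sigma_finite N
    by (intro product_sigma_finite.intro prob_space_imp_sigma_finite N)
  interpret N': product_sigma_finite ?N'
    using N Q(1) by (intro product_sigma_finite.intro prob_space_imp_sigma_finite) simp
  interpret J: prob_space "PiM ?J N" by (rule prob_space_PiM) (rule N)
  have [measurable_cong]: "sets (PiM I ?N') = sets (PiM I N)"
    by (rule sets_PiM_cong) (use Q in auto)
  \<comment> \<open>The two product laws differ only in coordinate \<open>i\<close>, so the outer
    integral is the same for both and the pointwise bound can be integrated.\<close>
  have J_eq: "PiM ?J ?N' = PiM ?J N" by (rule PiM_cong) auto
  have f_ins: "f \<in> borel_measurable (PiM (insert i ?J) N)" and g_ins: "g \<in> borel_measurable (PiM (insert i ?J) N)"
    unfolding I_eq by (fact f, fact g)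
  have g': "g \<in> borel_measurable (PiM (insert i ?J) ?N')"
    unfolding I_eq by measurable
  have upd: "(\<lambda>(x, y). x(i := y)) \<in> measurable (PiM ?J N \<Otimes>\<^sub>M N i) (PiM (insert i ?J) N)"
    by (rule measurable_add_dim)
  have sets_pair: "sets (PiM ?J N \<Otimes>\<^sub>M Q) = sets (PiM ?J N \<Otimes>\<^sub>M N i)"
    by (rule sets_pair_measure_cong[OF refl Q(2)])
  have updQ: "(\<lambda>(x, y). x(i := y)) \<in> measurable (PiM ?J N \<Otimes>\<^sub>M Q) (PiM (insert i ?J) N)"
    using upd unfolding measurable_cong_sets[OF sets_pair refl] .
  have mf: "(\<lambda>x. \<integral>\<^sup>+y. f (x(i := y)) \<partial>N i) \<in> borel_measurable (PiM ?J N)"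
    by (rule sigma_finite_measure.borel_measurable_nn_integral[OF prob_space_imp_sigma_finite[OF N]])
       (use measurable_compose[OF upd f_ins] in \<open>simp add: case_prod_unfold\<close>)
  have mg: "(\<lambda>x. \<integral>\<^sup>+y. g (x(i := y)) \<partial>Q) \<in> borel_measurable (PiM ?J N)"
    by (rule sigma_finite_measure.borel_measurable_nn_integral[OF prob_space_imp_sigma_finite[OF Q(1)]])
       (use measurable_compose[OF updQ g_ins] in \<open>simp add: case_prod_unfold\<close>)
  have "K = (\<integral>\<^sup>+x. K \<partial>PiM ?J N)" by (simp add: J.emeasure_space_1)
  also have "\<dots> \<le> (\<integral>\<^sup>+x. (\<integral>\<^sup>+y. f (x(i := y)) \<partial>N i) + (\<integral>\<^sup>+y. g (x(i := y)) \<partial>Q) \<partial>PiM ?J N)"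
    by (intro nn_integral_mono le)
  also have "\<dots> = (\<integral>\<^sup>+x. \<integral>\<^sup>+y. f (x(i := y)) \<partial>N i \<partial>PiM ?J N)
      + (\<integral>\<^sup>+x. \<integral>\<^sup>+y. g (x(i := y)) \<partial>Q \<partial>PiM ?J N)"
    by (rule nn_integral_add[OF mf mg])
  also have "(\<integral>\<^sup>+x. \<integral>\<^sup>+y. f (x(i := y)) \<partial>N i \<partial>PiM ?J N) = integral\<^sup>N (PiM (insert i ?J) N) f"
    by (rule N.product_nn_integral_insert[OF _ _ f_ins, symmetric]) (use I in simp_all)
  also have "(\<integral>\<^sup>+x. \<integral>\<^sup>+y. g (x(i := y)) \<partial>Q \<partial>PiM ?J N) = integral\<^sup>N (PiM (insert i ?J) ?N') g"
    by (subst N'.product_nn_integral_insert[OF _ _ g']) (use I in \<open>simp_all add: J_eq\<close>)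
  finally show ?thesis unfolding I_eq .
qed

text \<open>The vertices of the cube are paired along the edges in direction \<open>i\<close>, as in Assouad's lemma.\<close>

lemma hypercube_average:
  fixes R :: "'i \<Rightarrow> ('i \<Rightarrow> 'a) \<Rightarrow> ennreal"
  assumes I: "finite I" and ab: "a \<noteq> b"
    and pair: "\<And>\<mu> i. \<mu> \<in> (\<Pi>\<^sub>E i\<in>I. {a, b}) \<Longrightarrow> i \<in> I \<Longrightarrow> \<mu> i = a \<Longrightarrow> K \<le> R i \<mu> + R i (\<mu>(i := b))"
    and S: "\<And>\<mu>. \<mu> \<in> (\<Pi>\<^sub>E i\<in>I. {a, b}) \<Longrightarrow> (\<Sum>i\<in>I. R i \<mu>) \<le> S"
  shows "of_nat (card I) * K \<le> 2 * S"
proof -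
  let ?C = "\<Pi>\<^sub>E i\<in>I. {a, b}"
  define flip where "flip i \<mu> = \<mu>(i := if \<mu> i = a then b else a)" for i and \<mu> :: "'i \<Rightarrow> 'a"
  have C: "finite ?C" "?C \<noteq> {}" using I by (auto intro!: finite_PiE simp: PiE_eq_empty_iff)
  have flip: "flip i \<mu> \<in> ?C" "flip i (flip i \<mu>) = \<mu>" if "\<mu> \<in> ?C" "i \<in> I" for i \<mu>
    using that ab by (auto simp: flip_def PiE_iff extensional_def fun_eq_iff)
  \<comment> \<open>\<open>pair\<close> speaks about the endpoint with value \<open>a\<close>; at
    the other endpoint it is applied to the flipped vertex.\<close>
  have pair': "K \<le> R i \<mu> + R i (flip i \<mu>)" if \<mu>: "\<mu> \<in> ?C" and i: "i \<in> I" for i \<mu>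
  proof (cases "\<mu> i = a")
    case True
    then show ?thesis using pair[OF \<mu> i] by (simp add: flip_def)
  next
    case False
    then have "\<mu> i = b" using \<mu> i by (auto simp: PiE_iff)
    then have "(flip i \<mu>) i = a" "(flip i \<mu>)(i := b) = \<mu>" using ab by (auto simp: flip_def fun_eq_iff)
    then show ?thesis using pair[OF flip(1)[OF \<mu> i] i] by (simp add: add.commute)
  qed
  have sum2: "of_nat (card ?C) * K \<le> 2 * (\<Sum>\<mu>\<in>?C. R i \<mu>)" if i: "i \<in> I" for i
  proof -
    have "of_nat (card ?C) * K = (\<Sum>\<mu>\<in>?C. K)" by simp
    also have "\<dots> \<le> (\<Sum>\<mu>\<in>?C. R i \<mu> + R i (flip i \<mu>))" by (intro sum_mono pair' i)
    also have "\<dots> = (\<Sum>\<mu>\<in>?C. R i \<mu>) + (\<Sum>\<mu>\<in>?C. R i (flip i \<mu>))" by (rule sum.distrib)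
    \<comment> \<open>The flip is an involution of the cube, so both sums agree and the factor 2
      arises.\<close>
    also have "(\<Sum>\<mu>\<in>?C. R i (flip i \<mu>)) = (\<Sum>\<mu>\<in>?C. R i \<mu>)"
      by (rule sum.reindex_bij_witness[of _ "flip i" "flip i"]) (use flip i in auto)
    finally show ?thesis by (simp add: mult_2)
  qed
  have "of_nat (card ?C) * (of_nat (card I) * K) = (\<Sum>i\<in>I. of_nat (card ?C) * K)"
    by (simp add: mult.left_commute)
  also have "\<dots> \<le> (\<Sum>i\<in>I. 2 * (\<Sum>\<mu>\<in>?C. R i \<mu>))" by (intro sum_mono sum2)
  also have "\<dots> = 2 * (\<Sum>\<mu>\<in>?C. \<Sum>i\<in>I. R i \<mu>)"
    by (subst sum.swap) (simp add: sum_distrib_left)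
  also have "\<dots> \<le> 2 * (\<Sum>\<mu>\<in>?C. S)" by (intro mult_left_mono sum_mono S) auto
  also have "\<dots> = of_nat (card ?C) * (2 * S)" by (simp add: mult.left_commute)
  finally show ?thesis
    using C by (subst (asm) ennreal_mult_le_mult_iff) (auto simp: ennreal_of_nat_eq_real_of_nat)
qed

section \<open>Minimax lower bound\<close>

context regular_exp_family
begin

text \<open>The supremum over the box is at least the average risk over the vertices of the cube
  with corners \<open>m0\<close> and \<open>m1\<close>. Each coordinate gives 1/4 by
  \<open>two_point_risk\<close>, shared between the two endpoints of an edge, hence 1/8.\<close>

lemma two_point_lower_bound:
  assumes V: "Vmin \<in> deriv b ` \<Theta>" "Vmax \<in> deriv b ` \<Theta>" "Vmin < Vmax"
    and est: "est \<in> estimators n"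
    and m: "Vmin \<le> m0" "m0 < m1" "m1 \<le> Vmax"
    and le: "(np m1 - np m0) * (m1 - m0) \<le> 1"
  shows "ennreal (real n * (m1 - m0)\<^sup>2 / 8) \<le> (SUP \<mu>\<in>mean_box n Vmin Vmax. risk \<rho> c \<Theta> b n est \<mu>)"
    (is "_ \<le> ?S")
proof -
  have m01: "m0 \<in> {Vmin..Vmax}" "m1 \<in> {Vmin..Vmax}" using m by auto
  note np0 = natural_param[OF V m01(1)] and np1 = natural_param[OF V m01(2)]
  have less: "np m0 < np m1" using deriv_log_partition_less_iff[OF np0(1) np1(1)] np0(2) np1(2) m(2) by simp
  let ?C = "\<Pi>\<^sub>E i\<in>{..<n}. {m0, m1}"
  define R where "R i \<mu> = (\<integral>\<^sup>+x. ennreal ((est x i - \<mu> i)\<^sup>2) \<partial>data_law \<rho> c \<Theta> b n \<mu>)" for i \<mu>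
  have sets_law: "sets (data_law \<rho> c \<Theta> b n \<mu>) = sets (\<Pi>\<^sub>M i\<in>{..<n}. (borel :: real measure))" for \<mu>
    unfolding data_law_def by (rule sets_PiM_cong) auto
  have est_i: "(\<lambda>x. est x i) \<in> borel_measurable (\<Pi>\<^sub>M i\<in>{..<n}. (borel :: real measure))" if "i < n" for i
    using measurable_compose[OF est[unfolded estimators_def] measurable_component_singleton] that by simp
  have meas: "(\<lambda>x. ennreal ((est x i - u)\<^sup>2)) \<in> borel_measurable (data_law \<rho> c \<Theta> b n \<mu>)" if "i < n" for i u \<mu>
    using est_i[OF that] by (simp add: measurable_cong_sets[OF sets_law refl])
  have pair: "ennreal ((m1 - m0)\<^sup>2 / 4) \<le> R i \<mu> + R i (\<mu>(i := m1))"
    if \<mu>: "\<mu> \<in> ?C" and i: "i \<in> {..<n}" and \<mu>i: "\<mu> i = m0" for i \<mu>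
  proof -
    \<comment> \<open>\<open>nn_integral_PiM_pair_ge\<close> asks for a probability measure at every
      index; \<open>m0\<close> fills the indices from \<open>n\<close> on.\<close>
    define N where "N j = P (np (if j < n then \<mu> j else m0))" for j
    have "(if j < n then \<mu> j else m0) \<in> {m0, m1}" for j using PiE_mem[OF \<mu>, of j] by auto
    then have N: "prob_space (N j)" for j
      unfolding N_def using np0(1) np1(1) by (intro prob_space_family) (metis insertE singletonD)
    have law: "data_law \<rho> c \<Theta> b n \<mu> = PiM {..<n} N"
      unfolding data_law_def by (rule PiM_cong) (auto simp: N_def)
    have law': "data_law \<rho> c \<Theta> b n (\<mu>(i := m1)) = PiM {..<n} (N(i := P (np m1)))"
      unfolding data_law_def by (rule PiM_cong) (auto simp: N_def)
    have Ni: "N i = P (np m0)" using i \<mu>i by (simp add: N_def)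
    show ?thesis
      unfolding R_def law law'
    proof (rule nn_integral_PiM_pair_ge)
      show "finite {..<n}" "i \<in> {..<n}" "prob_space (P (np m1))" "sets (P (np m1)) = sets (N i)"
        using i np1(1) by (simp_all add: N_def prob_space_family)
      show "prob_space (N j)" for j by (rule N)
      show "(\<lambda>x. ennreal ((est x i - \<mu> i)\<^sup>2)) \<in> borel_measurable (PiM {..<n} N)"
        "(\<lambda>x. ennreal ((est x i - (\<mu>(i := m1)) i)\<^sup>2)) \<in> borel_measurable (PiM {..<n} N)"
        unfolding law[symmetric] by (rule meas, use i in simp)+
      fix x
      assume x: "x \<in> space (PiM ({..<n} - {i}) N)"
      \<comment> \<open>With the other coordinates frozen, coordinate \<open>i\<close> of the
        estimator becomes a measurable function of the one observation \<open>y\<close>, to which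
        the two-point bound applies.\<close>
      have "(\<lambda>y j. (x(i := y)) j) \<in> measurable borel (\<Pi>\<^sub>M i\<in>{..<n}. (borel :: real measure))"
      proof (rule measurable_PiM_single')
        show "(\<lambda>y. (x(i := y)) j) \<in> borel_measurable borel" for j by (cases "j = i") auto
        show "(\<lambda>y j. (x(i := y)) j) \<in> space borel \<rightarrow> (\<Pi>\<^sub>E i\<in>{..<n}. space (borel :: real measure))"
          using x i by (auto simp: space_PiM PiE_iff extensional_def)
      qed
      from measurable_compose[OF this est_i]
      have "(\<lambda>y. est (x(i := y)) i) \<in> borel_measurable borel" using i by (simp add: fun_upd_def)
      from two_point_risk[OF this np0(1) np1(1) less] le
      show "ennreal ((m1 - m0)\<^sup>2 / 4) \<le> (\<integral>\<^sup>+y. ennreal ((est (x(i := y)) i - \<mu> i)\<^sup>2) \<partial>N i)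
          + (\<integral>\<^sup>+y. ennreal ((est (x(i := y)) i - (\<mu>(i := m1)) i)\<^sup>2) \<partial>P (np m1))"
        by (simp add: np0(2) np1(2) \<mu>i Ni)
    qed
  qed
  have "(\<Sum>i\<in>{..<n}. R i \<mu>) \<le> ?S" if \<mu>: "\<mu> \<in> ?C" for \<mu>
  proof -
    have "(\<Sum>i\<in>{..<n}. R i \<mu>) = (\<integral>\<^sup>+x. (\<Sum>i<n. ennreal ((est x i - \<mu> i)\<^sup>2)) \<partial>data_law \<rho> c \<Theta> b n \<mu>)"
      unfolding R_def by (rule nn_integral_sum[symmetric]) (rule meas, simp)
    also have "\<dots> = risk \<rho> c \<Theta> b n est \<mu>"
      by (simp add: risk_def L2_set_def sum_nonneg sum_ennreal)
    also have "\<mu> \<in> mean_box n Vmin Vmax"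
      unfolding mean_box_def by (rule subsetD[OF PiE_mono \<mu>]) (use m01 in auto)
    then have "risk \<rho> c \<Theta> b n est \<mu> \<le> ?S" by (rule SUP_upper)
    finally show ?thesis .
  qed
  then have "of_nat (card {..<n}) * ennreal ((m1 - m0)\<^sup>2 / 4) \<le> 2 * ?S"
    using m(2) by (intro hypercube_average[where a = m0 and b = m1 and R = R] pair) auto
  then have "ennreal (1 / 2) * (of_nat n * ennreal ((m1 - m0)\<^sup>2 / 4)) \<le> ennreal (1 / 2) * (2 * ?S)"
    by (intro mult_left_mono) simp_all
  also have "ennreal (1 / 2) * (2 * ?S) = (ennreal (1 / 2) * ennreal 2) * ?S" by (simp add: mult.assoc)
  also have "ennreal (1 / 2) * ennreal 2 = 1" by (subst ennreal_mult[symmetric]) auto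
  also have "of_nat n * ennreal ((m1 - m0)\<^sup>2 / 4) = ennreal (real n * ((m1 - m0)\<^sup>2 / 4))"
    unfolding ennreal_of_nat_eq_real_of_nat by (rule ennreal_mult[symmetric]) auto
  also have "ennreal (1 / 2) * ennreal (real n * ((m1 - m0)\<^sup>2 / 4)) = ennreal (1 / 2 * (real n * ((m1 - m0)\<^sup>2 / 4)))"
    by (rule ennreal_mult[symmetric]) auto
  finally show ?thesis by simp
qed

lemma minimax_lower_bound:
  assumes V: "Vmin \<in> deriv b ` \<Theta>" "Vmax \<in> deriv b ` \<Theta>" "Vmin < Vmax"
    and \<sigma>: "\<sigma> > 0" and C: "Cvar > 0" "Cint > 0"
    and W: "{Wmin..Wmax} \<subseteq> {Vmin..Vmax}" "Wmax - Wmin \<ge> Cint * (Vmax - Vmin)"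
    and var: "\<And>\<mu>. \<mu> \<in> {Wmin..Wmax} \<Longrightarrow> deriv (deriv b) (np \<mu>) \<ge> Cvar * \<sigma>\<^sup>2"
    and est: "est \<in> estimators n"
  shows "ennreal (real n * min (Cvar * \<sigma>\<^sup>2) (Cint\<^sup>2 * (Vmax - Vmin)\<^sup>2) / 8)
    \<le> (SUP \<mu>\<in>mean_box n Vmin Vmax. risk \<rho> c \<Theta> b n est \<mu>)"
proof -
  \<comment> \<open>The distance of the two means: short enough to fit into the interval of large
    variance, and at most the standard deviation guaranteed there, so that the two laws
    overlap.\<close>
  define \<delta> where "\<delta> = min (sqrt Cvar * \<sigma>) (Cint * (Vmax - Vmin))"
  have pos: "sqrt Cvar * \<sigma> > 0" "Cint * (Vmax - Vmin) > 0" using V \<sigma> C by auto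
  then have \<delta>: "\<delta> > 0" "\<delta> \<le> Wmax - Wmin" "\<delta> \<le> sqrt Cvar * \<sigma>" using W(2) by (auto simp: \<delta>_def)
  have \<delta>2: "\<delta>\<^sup>2 = min (Cvar * \<sigma>\<^sup>2) (Cint\<^sup>2 * (Vmax - Vmin)\<^sup>2)"
  proof -
    have "\<delta>\<^sup>2 = min ((sqrt Cvar * \<sigma>)\<^sup>2) ((Cint * (Vmax - Vmin))\<^sup>2)"
      using pos power_mono_iff[of "sqrt Cvar * \<sigma>" "Cint * (Vmax - Vmin)" 2]
      unfolding \<delta>_def min_def by auto
    then show ?thesis using C by (simp add: power_mult_distrib)
  qed
  have W_sub: "\<mu> \<in> {Vmin..Vmax}" if "\<mu> \<in> {Wmin..Wmax}" for \<mu> using W(1) that by blast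
  let ?m1 = "Wmin + \<delta>"
  have mem: "Wmin \<in> {Wmin..Wmax}" "?m1 \<in> {Wmin..Wmax}" using \<delta> by auto
  note np0 = natural_param[OF V W_sub[OF mem(1)]] and np1 = natural_param[OF V W_sub[OF mem(2)]]
  have less: "np Wmin < np ?m1"
    using deriv_log_partition_less_iff[OF np0(1) np1(1)] np0(2) np1(2) \<delta>(1) by simp
  have sub: "{np Wmin..np ?m1} \<subseteq> \<Theta>" by (rule atLeastAtMost_subset_params[OF np0(1) np1(1)])
  have D: "(deriv b has_real_derivative deriv (deriv b) x) (at x)" if "x \<in> {np Wmin..np ?m1}" for x
    using has_field_derivative_log_partition(2) sub that by blast
  \<comment> \<open>The mean value theorem for \<open>b'\<close> turns the distance of the means
    into that of the parameters. The intermediate point has its mean in the large-variance interval,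
    whence \<open>(np ?m1 - np Wmin) * \<delta> \<le> \<delta>\<^sup>2 / (Cvar * \<sigma>\<^sup>2)
    \<le> 1\<close>.\<close>
  have "\<exists>x>np Wmin. x < np ?m1 \<and> deriv b (np ?m1) - deriv b (np Wmin) = (np ?m1 - np Wmin) * deriv (deriv b) x"
    by (rule MVT2[OF less D]) (use less in auto)
  then obtain x where x: "np Wmin < x" "x < np ?m1" "\<delta> = (np ?m1 - np Wmin) * deriv (deriv b) x"
    using np0(2) np1(2) by auto
  have x\<Theta>: "x \<in> \<Theta>" using x sub by auto
  have "deriv b (np Wmin) < deriv b x" "deriv b x < deriv b (np ?m1)"
    using deriv_log_partition_strict_mono np0(1) np1(1) x\<Theta> x by auto
  then have "deriv b x \<in> {Wmin..Wmax}" using np0(2) np1(2) mem by auto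
  from var[OF this] have "Cvar * \<sigma>\<^sup>2 \<le> deriv (deriv b) x" by (simp add: natural_param_deriv x\<Theta>)
  then have "(np ?m1 - np Wmin) * (Cvar * \<sigma>\<^sup>2) \<le> (np ?m1 - np Wmin) * deriv (deriv b) x"
    using less by (intro mult_left_mono) auto
  also have "\<dots> = \<delta>" by (rule x(3)[symmetric])
  finally have "(np ?m1 - np Wmin) * (Cvar * \<sigma>\<^sup>2) * \<delta> \<le> \<delta>\<^sup>2"
    using \<delta>(1) by (simp add: power2_eq_square mult_right_mono)
  also have "\<delta>\<^sup>2 \<le> Cvar * \<sigma>\<^sup>2" by (simp add: \<delta>2)
  finally have "(np ?m1 - np Wmin) * \<delta> * (Cvar * \<sigma>\<^sup>2) \<le> 1 * (Cvar * \<sigma>\<^sup>2)" by (simp add: mult_ac)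
  moreover have "Cvar * \<sigma>\<^sup>2 > 0" using C \<sigma> by simp
  ultimately have "(np ?m1 - np Wmin) * \<delta> \<le> 1" by (simp only: mult_le_cancel_right_pos)
  then have "(np ?m1 - np Wmin) * (?m1 - Wmin) \<le> 1" by simp
  from two_point_lower_bound[OF V est _ _ _ this] \<delta>(1) W_sub[OF mem(1)] W_sub[OF mem(2)]
  show ?thesis by (simp add: \<delta>2)
qed

end

text \<open>Here \<open>r\<close> is the range of means in units of \<open>\<sigma>\<close>. The
  hypothesis amounts to \<open>1 / n \<le> r^2\<close>, so \<open>r / n \<le> r^3\<close>, and the
  power 2/3 brings this down to \<open>r^2\<close>; both summands of the rate are thus at most
  \<open>r^2\<close>.\<close>

lemma rate_le_min_square:
  fixes r :: real
  assumes n: "n \<ge> 1" and r: "r \<ge> 1 / sqrt (real n)"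
  shows "min 1 ((r / real n) powr (2 / 3) + 1 / real n) \<le> 2 * min 1 (r\<^sup>2)"
proof -
  have r0: "r > 0" using r n by (smt (verit) divide_pos_pos of_nat_0_less_iff real_sqrt_gt_zero less_le_trans zero_less_one One_nat_def Suc_le_eq)
  have "(1 / sqrt (real n))\<^sup>2 \<le> r\<^sup>2" using r by (intro power_mono) auto
  then have n_le: "1 / real n \<le> r\<^sup>2" using n by (simp add: power_divide)
  then have "r * (1 / real n) \<le> r * r\<^sup>2" using r0 by (intro mult_left_mono) auto
  then have "(r / real n) powr (2 / 3) \<le> (r ^ 3) powr (2 / 3)"
    using r0 by (intro powr_mono2) (auto simp: power2_eq_square power3_eq_cube)
  also have "(r ^ 3) powr (2 / 3) = (r powr 3) powr (2 / 3)" using r0 by simp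
  also have "\<dots> = r\<^sup>2" using r0 by (simp only: powr_powr) simp
  finally have "(r / real n) powr (2 / 3) + 1 / real n \<le> 2 * r\<^sup>2" using n_le by simp
  then show ?thesis by (auto simp: min_def)
qed

theorem theorem4:
  fixes Cvar Cint :: real
  assumes "Cvar > 0" and "Cint > 0"
  shows "\<exists>C1>0. \<exists>C2>0.
    \<forall>n\<ge>2. \<forall>\<rho> c \<Theta> b Vmin Vmax Wmin Wmax \<sigma>.
      regular_exp_family \<rho> c \<Theta> b \<longrightarrow>
      Vmin \<in> deriv b ` \<Theta> \<longrightarrow> Vmax \<in> deriv b ` \<Theta> \<longrightarrow> Vmin < Vmax \<longrightarrow>
      \<sigma> \<ge> 0 \<longrightarrow> \<sigma>\<^sup>2 = max_variance \<Theta> b Vmin Vmax \<longrightarrow>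
      Vmax - Vmin \<ge> \<sigma> / sqrt (real n) \<longrightarrow>
      {Wmin..Wmax} \<subseteq> {Vmin..Vmax} \<longrightarrow>
      Wmax - Wmin \<ge> Cint * (Vmax - Vmin) \<longrightarrow>
      (\<forall>\<mu>\<in>{Wmin..Wmax}. deriv (deriv b) (natural_param \<Theta> b \<mu>) \<ge> Cvar * \<sigma>\<^sup>2) \<longrightarrow>
        (\<forall>\<pi>. (\<forall>\<mu>\<in>mean_box n Vmin Vmax. sorting_perm n \<mu> (\<pi> \<mu>)) \<longrightarrow>
          (SUP \<mu>\<in>mean_box n Vmin Vmax. risk \<rho> c \<Theta> b n (isotonic_lse n (\<pi> \<mu>)) \<mu>)
          \<le> ennreal (C1 * real n * \<sigma>\<^sup>2 *
               min 1 (((Vmax - Vmin) / (real n * \<sigma>)) powr (2 / 3) + ln (real n) / real n))) \<and>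
        (INF est\<in>estimators n. SUP \<mu>\<in>mean_box n Vmin Vmax. risk \<rho> c \<Theta> b n est \<mu>)
          \<ge> ennreal (C2 * real n * \<sigma>\<^sup>2 *
               min 1 (((Vmax - Vmin) / (real n * \<sigma>)) powr (2 / 3) + 1 / real n))"
proof -
  \<comment> \<open>\<open>K\<close> bounds the constants of both terms of the minimum in
    \<open>minimax_lower_bound\<close>; the 16 is the 8 from there times the 2 from
    \<open>rate_le_min_square\<close>.\<close>
  define K where "K = min Cvar (Cint\<^sup>2)"
  define C2 where "C2 = K / 16"
  have C2: "C2 > 0" using assms by (simp add: C2_def K_def)
  show ?thesis
  proof (rule exI[of _ 528], intro conjI exI[of _ C2] C2 allI impI)
    fix n :: nat and \<rho> :: "real measure" and c b :: "real \<Rightarrow> real" and \<Theta> :: "real set"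
      and Vmin Vmax Wmin Wmax \<sigma> :: real
    assume n: "2 \<le> n" and fam: "regular_exp_family \<rho> c \<Theta> b"
      and V: "Vmin \<in> deriv b ` \<Theta>" "Vmax \<in> deriv b ` \<Theta>" "Vmin < Vmax"
      and \<sigma>: "0 \<le> \<sigma>" "\<sigma>\<^sup>2 = max_variance \<Theta> b Vmin Vmax"
      and V\<sigma>: "\<sigma> / sqrt (real n) \<le> Vmax - Vmin"
      and W: "{Wmin..Wmax} \<subseteq> {Vmin..Vmax}" "Cint * (Vmax - Vmin) \<le> Wmax - Wmin"
      and var: "\<forall>\<mu>\<in>{Wmin..Wmax}. Cvar * \<sigma>\<^sup>2 \<le> deriv (deriv b) (natural_param \<Theta> b \<mu>)"
    interpret regular_exp_family \<rho> c \<Theta> b by (rule fam)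
    have \<sigma>0: "\<sigma> > 0" using max_variance(1)[OF V] \<sigma> by (cases "\<sigma> = 0") auto
    show "(SUP \<mu>\<in>mean_box n Vmin Vmax. risk \<rho> c \<Theta> b n (isotonic_lse n (\<pi> \<mu>)) \<mu>)
          \<le> ennreal (528 * real n * \<sigma>\<^sup>2 *
               min 1 (((Vmax - Vmin) / (real n * \<sigma>)) powr (2 / 3) + ln (real n) / real n))"
      if "\<forall>\<mu>\<in>mean_box n Vmin Vmax. sorting_perm n \<mu> (\<pi> \<mu>)" for \<pi>
      using that by (intro SUP_least isotonic_lse_risk[OF V n \<sigma>0 \<sigma>(2)]) auto
    define r where "r = (Vmax - Vmin) / \<sigma>"
    have r: "r \<ge> 1 / sqrt (real n)" using V\<sigma> \<sigma>0 by (simp add: r_def field_simps)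
    have "C2 * real n * \<sigma>\<^sup>2 * min 1 (((Vmax - Vmin) / (real n * \<sigma>)) powr (2 / 3) + 1 / real n)
        \<le> C2 * real n * \<sigma>\<^sup>2 * (2 * min 1 (r\<^sup>2))"
      using rate_le_min_square[OF _ r] n C2 by (intro mult_left_mono) (auto simp: r_def mult.commute)
    also have "\<dots> = real n * (K * (\<sigma>\<^sup>2 * min 1 (r\<^sup>2))) / 8" by (simp add: C2_def)
    also have "\<sigma>\<^sup>2 * min 1 (r\<^sup>2) = min (\<sigma>\<^sup>2) ((Vmax - Vmin)\<^sup>2)"
      using \<sigma>0 by (simp add: r_def min_mult_distrib_left power_divide)
    also have "real n * (K * min (\<sigma>\<^sup>2) ((Vmax - Vmin)\<^sup>2)) / 8
        \<le> real n * min (Cvar * \<sigma>\<^sup>2) (Cint\<^sup>2 * (Vmax - Vmin)\<^sup>2) / 8"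
      using assms by (intro divide_right_mono mult_left_mono min.boundedI mult_mono) (auto simp: K_def)
    finally have rate: "C2 * real n * \<sigma>\<^sup>2 * min 1 (((Vmax - Vmin) / (real n * \<sigma>)) powr (2 / 3) + 1 / real n)
        \<le> real n * min (Cvar * \<sigma>\<^sup>2) (Cint\<^sup>2 * (Vmax - Vmin)\<^sup>2) / 8" .
    show "(INF est\<in>estimators n. SUP \<mu>\<in>mean_box n Vmin Vmax. risk \<rho> c \<Theta> b n est \<mu>)
          \<ge> ennreal (C2 * real n * \<sigma>\<^sup>2 *
               min 1 (((Vmax - Vmin) / (real n * \<sigma>)) powr (2 / 3) + 1 / real n))"
      using var by (intro INF_greatest order_trans[OF ennreal_leI[OF rate]]
          minimax_lower_bound[OF V \<sigma>0 assms W]) auto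
  qed auto
qed

end
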